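(* Biholomorphism classes of Inoue surfaces of type I correspond bijectively to elements of the set $$\{(\mathfrak{M},\beta)\mid \mathfrak{M}\in\mathcal{M}/\!\sim,\ \beta\in\mathrm{Spec}_{\mathbb{C}}(\mathfrak{M})\setminus\mathrm{Spec}_{\mathbb{R}}(\mathfrak{M})\}=\coprod_{\mathfrak{M}\in\mathcal{M}/\sim}\big(\mathrm{Spec}_{\mathbb{C}}(\mathfrak{M})\setminus\mathrm{Spec}_{\mathbb{R}}(\mathfrak{M})\big).$$ The pair corresponding to the surface $S^{\beta}_{a,b}$ is $([M(\beta,a,b)],\beta)$.
   Context: $H=\{w\in\mathbb{C}\mid\mathrm{Im}(w)>0\}$, $U=H\times\mathbb{C}$ with coordinates $(w,z)$. A number $\beta\in\mathbb{C}\setminus\mathbb{R}$ with $|\beta|<1$ is admissible if $|\beta|^{-2},\beta,\bar\beta$ are the roots of a polynomial $X^3-\theta_2X^2+\theta_1X-1$ with $\theta_1,\theta_2\in\mathbb{Z}$. For an admissible $\beta$, a pair $(a,b)\in\mathbb{R}^3\times\mathbb{C}^3$ is $\beta$-compatible if $a,b,\bar b$ are linearly independent over $\mathbb{C}$ and, $P$ being the matrix with columns $a,b,\bar b$, $$M(\beta,a,b):=P\,\mathrm{diag}(|\beta|^{-2},\beta,\bar\beta)\,P^{-1}\in M_3(\mathbb{Z});$$ then $M(\beta,a,b)\in\mathrm{SL}(3,\mathbb{Z})$. The type I Inoue surfaces are the compact complex surfaces $S^{\beta}_{a,b}=U/G(\beta,a,b)$, with $\beta$ admissible and $(a,b)$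 $\beta$-compatible, where $G(\beta,a,b)$ is the group (acting properly discontinuously on $U$) generated by $(w,z)\mapsto(|\beta|^{-2}w,\beta z)$ and $(w,z)\mapsto(w+a_i,z+b_i)$, $1\le i\le 3$. For a square integer matrix $M$, $\mathrm{Spec}_{\mathbb{C}}(M)$ and $\mathrm{Spec}_{\mathbb{R}}(M)$ denote the sets of its complex and real eigenvalues, and $$\mathcal{M}=\{M\in\mathrm{SL}(3,\mathbb{Z})\mid \mathrm{Spec}_{\mathbb{C}}(M)\supsetneq\mathrm{Spec}_{\mathbb{R}}(M)\subset\,]1,+\infty[\,\}.$$ $\sim$ is the equivalence relation on $\mathcal{M}$ given by conjugation by matrices in $\mathrm{GL}(3,\mathbb{Z})$; for a class $\mathfrak{M}=[M]$ put $\mathrm{Spec}_{\mathbb{R}}(\mathfrak{M})=\mathrm{Spec}_{\mathbb{R}}(M)$, $\mathrm{Spec}_{\mathbb{C}}(\mathfrak{M})=\mathrm{Spec}_{\mathbb{C}}(M)$. *)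

theory Defs
  imports
    "HOL-Analysis.Analysis"
    "HOL-Computational_Algebra.Polynomial"
    "HOL-Algebra.Group_Action"
    "HOL-Algebra.Generated_Groups"
begin

section \<open>Complex surfaces and biholomorphisms\<close>

definition cscale :: "complex \<Rightarrow> complex \<times> complex \<Rightarrow> complex \<times> complex" where
  "cscale c v = (c * fst v, c * snd v)"

text \<open>Holomorphic maps between open subsets of the complex plane squared: Frechet differentiable
  with complex linear derivative. (The type \<^typ>\<open>complex \<times> complex\<close> is only a real normed space
  in the library.)\<close>

definition holomorphic2_on ::
    "(complex \<times> complex \<Rightarrow> complex \<times> complex) \<Rightarrow> (complex \<times> complex) set \<Rightarrow> bool" where
  "holomorphic2_on f S \<longleftrightarrow>
     (\<forall>p\<in>S. \<exists>D. (f has_derivative D) (at p within S) \<and> (\<forall>c v. D (cscale c v) = cscale c (D v)))"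

text \<open>A complex surface is given by a topological space and an atlas. An element \<open>(V, \<phi>)\<close> of the
  atlas is a chart with domain \<open>V\<close>; the values of \<open>\<phi>\<close> outside \<open>V\<close> are irrelevant.\<close>

record 'p complex_surface =
  top_space :: "'p topology"
  atlas :: "('p set \<times> ('p \<Rightarrow> complex \<times> complex)) set"

definition holomorphic_map ::
    "'p complex_surface \<Rightarrow> 'q complex_surface \<Rightarrow> ('p \<Rightarrow> 'q) \<Rightarrow> bool" where
  "holomorphic_map X Y f \<longleftrightarrow>
     continuous_map (top_space X) (top_space Y) f \<and>
     (\<forall>(V, \<phi>)\<in>atlas X. \<forall>(W, \<psi>)\<in>atlas Y.
        holomorphic2_on (\<psi> \<circ> f \<circ> inv_into V \<phi>) (\<phi> ` {x \<in> V. f x \<in> W}))"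

definition biholomorphic :: "'p complex_surface \<Rightarrow> 'q complex_surface \<Rightarrow> bool" where
  "biholomorphic X Y \<longleftrightarrow>
     (\<exists>f g. homeomorphic_maps (top_space X) (top_space Y) f g \<and>
            holomorphic_map X Y f \<and> holomorphic_map Y X g)"

section \<open>Quotients of domains by groups of automorphisms\<close>

text \<open>Let \<open>G\<close> be a group of bijections of an open set \<open>U\<close>, given as a subset of the carrier of
  \<^term>\<open>BijGroup U\<close>. The points of the quotient are the orbits.\<close>

abbreviation transf_group :: "'a set \<Rightarrow> ('a \<Rightarrow> 'a) set \<Rightarrow> ('a \<Rightarrow> 'a) monoid" where
  "transf_group U G \<equiv> BijGroup U \<lparr>carrier := G\<rparr>"

definition quot_proj :: "'a set \<Rightarrow> ('a \<Rightarrow> 'a) set \<Rightarrow> 'a \<Rightarrow> 'a set" where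
  "quot_proj U G = orbit (transf_group U G) (\<lambda>g. g)"

definition quot_space :: "'a set \<Rightarrow> ('a \<Rightarrow> 'a) set \<Rightarrow> 'a set set" where
  "quot_space U G = orbits (transf_group U G) U (\<lambda>g. g)"

definition quot_topology ::
    "('a::topological_space) set \<Rightarrow> ('a \<Rightarrow> 'a) set \<Rightarrow> 'a set topology" where
  "quot_topology U G =
     topology (\<lambda>W. W \<subseteq> quot_space U G \<and>
                   openin (top_of_set U) {p \<in> U. quot_proj U G p \<in> W})"

text \<open>The charts are the local inverses of the projection, i.e. its inverses over the images of open
  sets on which it is injective. When the action is free and properly discontinuous, they define the
  unique complex structure for which the projection is locally biholomorphic.\<close>

definition quot_surface ::
    "(complex \<times> complex) set \<Rightarrow> (complex \<times> complex \<Rightarrow> complex \<times> complex) set \<Rightarrow>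
     (complex \<times> complex) set complex_surface" where
  "quot_surface U G =
     \<lparr>top_space = quot_topology U G,
      atlas = {(quot_proj U G ` V, inv_into V (quot_proj U G)) | V.
                 open V \<and> V \<subseteq> U \<and> inj_on (quot_proj U G) V}\<rparr>"

lemma quot_proj_image: "quot_proj U G ` U = quot_space U G"
  by (auto simp: quot_proj_def quot_space_def orbits_def)

lemma openin_quot_topology:
  "openin (quot_topology U G) W \<longleftrightarrow>
     W \<subseteq> quot_space U G \<and> openin (top_of_set U) {p \<in> U. quot_proj U G p \<in> W}"
proof -
  let ?P = "\<lambda>W. W \<subseteq> quot_space U G \<and> openin (top_of_set U) {p \<in> U. quot_proj U G p \<in> W}"
  have "istopology ?P"
    unfolding istopology_def
  proof (intro conjI allI impI)
    fix S T assume "?P S" "?P T"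
    then show "S \<inter> T \<subseteq> quot_space U G" by blast
    have "{p \<in> U. quot_proj U G p \<in> S \<inter> T}
        = {p \<in> U. quot_proj U G p \<in> S} \<inter> {p \<in> U. quot_proj U G p \<in> T}" by blast
    with \<open>?P S\<close> \<open>?P T\<close> show "openin (top_of_set U) {p \<in> U. quot_proj U G p \<in> S \<inter> T}"
      by (simp add: openin_Int)
  next
    fix K assume K: "\<forall>S\<in>K. ?P S"
    then show "\<Union>K \<subseteq> quot_space U G" by blast
    have "{p \<in> U. quot_proj U G p \<in> \<Union>K} = (\<Union>S\<in>K. {p \<in> U. quot_proj U G p \<in> S})" by blast
    moreover have "openin (top_of_set U) (\<Union>S\<in>K. {p \<in> U. quot_proj U G p \<in> S})"
      using K by (intro openin_Union) blast
    ultimately show "openin (top_of_set U) {p \<in> U. quot_proj U G p \<in> \<Union>K}" by simp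
  qed
  then show ?thesis by (simp add: quot_topology_def topology_inverse')
qed

lemma quotient_map_quot_proj:
  "quotient_map (top_of_set U) (quot_topology U G) (quot_proj U G)"
proof -
  have "openin (quot_topology U G) (quot_space U G)"
  proof -
    have "{p \<in> U. quot_proj U G p \<in> quot_space U G} = U"
      using quot_proj_image[of U G] by blast
    then show ?thesis by (simp add: openin_quot_topology)
  qed
  then have "topspace (quot_topology U G) = quot_space U G"
    by (metis openin_quot_topology openin_subset openin_topspace subset_antisym)
  then show ?thesis
    by (simp add: quotient_map_def quot_proj_image openin_quot_topology)
qed

section \<open>Spectra and the set of conjugacy classes of matrices\<close>

definition eigenvalues :: "('a::field)^'n^'n \<Rightarrow> 'a set" where
  "eigenvalues A = {c. \<exists>v. v \<noteq> 0 \<and> A *v v = c *s v}"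

definition SpecC :: "int^'n^'n \<Rightarrow> complex set" where
  "SpecC M = eigenvalues (map_matrix of_int M)"

definition SpecR :: "int^'n^'n \<Rightarrow> real set" where
  "SpecR M = eigenvalues (map_matrix of_int M)"

definition calM :: "(int^3^3) set" where
  "calM = {M. det M = 1 \<and> complex_of_real ` SpecR M \<subset> SpecC M \<and> SpecR M \<subseteq> {1<..}}"

text \<open>Over the integers, \<^term>\<open>invertible\<close> means invertible with an integer inverse.\<close>

definition conj_rel :: "((int^3^3) \<times> (int^3^3)) set" where
  "conj_rel = {(M, N). M \<in> calM \<and> N \<in> calM \<and>
                       (\<exists>Q. invertible Q \<and> N = Q ** M ** matrix_inv Q)}"

definition class_SpecC :: "(int^3^3) set \<Rightarrow> complex set" where
  "class_SpecC K = the_elem (SpecC ` K)"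

definition class_SpecR :: "(int^3^3) set \<Rightarrow> real set" where
  "class_SpecR K = the_elem (SpecR ` K)"

lemma map_matrix_of_int_mult:
  "map_matrix of_int (A ** B) = (map_matrix of_int A ** map_matrix of_int B :: 'a::ring_1^'n^'n)"
  by (simp add: vec_eq_iff matrix_matrix_mult_def)

lemma map_matrix_of_int_mat_1: "map_matrix of_int (mat 1) = (mat 1 :: 'a::ring_1^'n^'n)"
  by (simp add: vec_eq_iff mat_def)

lemma eigenvalues_conj_subset:
  fixes A B :: "('a::field)^'n^'n"
  assumes "Q' ** Q = mat 1"
  shows "eigenvalues A \<subseteq> eigenvalues (Q ** A ** Q')"
proof
  fix c assume "c \<in> eigenvalues A"
  then obtain v where v: "v \<noteq> 0" "A *v v = c *s v" by (auto simp: eigenvalues_def)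
  have inv: "Q' *v (Q *v v) = v" using assms by (simp add: matrix_vector_mul_assoc)
  have "(Q ** A ** Q') *v (Q *v v) = Q *v (A *v (Q' *v (Q *v v)))"
    by (simp only: matrix_vector_mul_assoc matrix_mul_assoc)
  also have "\<dots> = c *s (Q *v v)" by (simp add: inv v vector_scalar_commute)
  finally have "(Q ** A ** Q') *v (Q *v v) = c *s (Q *v v)" .
  moreover have "Q *v v \<noteq> 0" using inv v(1) by auto
  ultimately show "c \<in> eigenvalues (Q ** A ** Q')" by (auto simp: eigenvalues_def)
qed

lemma eigenvalues_of_int_conj:
  fixes M Q :: "int^'n^'n"
  assumes "invertible Q"
  shows "eigenvalues (map_matrix of_int (Q ** M ** matrix_inv Q) :: 'a::field^'n^'n)
       = eigenvalues (map_matrix of_int M)"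
proof -
  define R where "R = (map_matrix of_int Q :: 'a^'n^'n)"
  define R' where "R' = (map_matrix of_int (matrix_inv Q) :: 'a^'n^'n)"
  define A where "A = (map_matrix of_int M :: 'a^'n^'n)"
  have "Q ** matrix_inv Q = mat 1 \<and> matrix_inv Q ** Q = mat 1"
    using someI_ex[OF assms[unfolded invertible_def]] by (simp add: matrix_inv_def)
  then have R: "R ** R' = mat 1" "R' ** R = mat 1"
    by (metis R_def R'_def map_matrix_of_int_mult map_matrix_of_int_mat_1)+
  have "R' ** (R ** A ** R') ** R = (R' ** R) ** A ** (R' ** R)"
    by (simp only: matrix_mul_assoc)
  then have "R' ** (R ** A ** R') ** R = A" by (simp add: R)
  then have "eigenvalues (R ** A ** R') = eigenvalues A"
    using eigenvalues_conj_subset[OF R(2), of A] eigenvalues_conj_subset[OF R(1), of "R ** A ** R'"]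
    by auto
  then show ?thesis by (simp add: R_def R'_def A_def map_matrix_of_int_mult)
qed

lemma class_Spec_eq:
  assumes "M \<in> calM"
  shows "class_SpecC (conj_rel `` {M}) = SpecC M" "class_SpecR (conj_rel `` {M}) = SpecR M"
proof -
  have 1: "invertible (mat 1 :: int^3^3)"
    by (auto simp: invertible_def intro!: exI[of _ "mat 1"])
  have "matrix_inv (mat 1 :: int^3^3) = mat 1"
    using someI_ex[OF 1[unfolded invertible_def]] by (simp add: matrix_inv_def)
  with 1 have "(M, M) \<in> conj_rel"
    using assms by (auto simp: conj_rel_def intro!: exI[of _ "mat 1"])
  then have "SpecC ` (conj_rel `` {M}) = {SpecC M}" "SpecR ` (conj_rel `` {M}) = {SpecR M}"
    by (fastforce simp: conj_rel_def SpecC_def SpecR_def eigenvalues_of_int_conj)+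
  then show "class_SpecC (conj_rel `` {M}) = SpecC M" "class_SpecR (conj_rel `` {M}) = SpecR M"
    by (simp_all add: class_SpecC_def class_SpecR_def)
qed

section \<open>Inoue surfaces of type I\<close>

definition admissible :: "complex \<Rightarrow> bool" where
  "admissible \<beta> \<longleftrightarrow> \<beta> \<notin> \<real> \<and> cmod \<beta> < 1 \<and>
     (\<exists>\<theta>\<^sub>1 \<theta>\<^sub>2 :: int.
        {x. poly [:-1, of_int \<theta>\<^sub>1, - of_int \<theta>\<^sub>2, 1:] x = 0}
          = {complex_of_real (1 / (cmod \<beta>)\<^sup>2), \<beta>, cnj \<beta>})"

definition cvec :: "real^'n \<Rightarrow> complex^'n" where
  "cvec a = (\<chi> i. complex_of_real (a $ i))"

definition cnj_vec :: "complex^'n \<Rightarrow> complex^'n" where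
  "cnj_vec b = (\<chi> i. cnj (b $ i))"

definition diag3 :: "'a::zero \<Rightarrow> 'a \<Rightarrow> 'a \<Rightarrow> 'a^3^3" where
  "diag3 x y z = (\<chi> i j. if i = j then vector [x, y, z] $ i else 0)"

definition Pmat :: "real^3 \<Rightarrow> complex^3 \<Rightarrow> complex^3^3" where
  "Pmat a b = transpose (vector [cvec a, b, cnj_vec b])"

definition Mmat :: "complex \<Rightarrow> real^3 \<Rightarrow> complex^3 \<Rightarrow> complex^3^3" where
  "Mmat \<beta> a b =
     Pmat a b ** diag3 (complex_of_real (1 / (cmod \<beta>)\<^sup>2)) \<beta> (cnj \<beta>) ** matrix_inv (Pmat a b)"

text \<open>Distinctness is needed because independence is required of the family, not of the set, of the
  three vectors.\<close>

definition compatible :: "complex \<Rightarrow> real^3 \<Rightarrow> complex^3 \<Rightarrow> bool" where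
  "compatible \<beta> a b \<longleftrightarrow>
     distinct [cvec a, b, cnj_vec b] \<and> vec.independent {cvec a, b, cnj_vec b} \<and>
     (\<exists>N :: int^3^3. map_matrix of_int N = Mmat \<beta> a b)"

text \<open>The matrix of a compatible pair as an integer matrix.\<close>

definition Mint :: "complex \<Rightarrow> real^3 \<Rightarrow> complex^3 \<Rightarrow> int^3^3" where
  "Mint \<beta> a b = (THE N. map_matrix of_int N = Mmat \<beta> a b)"

lemma map_matrix_Mint:
  assumes "compatible \<beta> a b"
  shows "map_matrix of_int (Mint \<beta> a b) = Mmat \<beta> a b"
proof -
  obtain N :: "int^3^3" where N: "map_matrix of_int N = Mmat \<beta> a b"
    using assms by (auto simp: compatible_def)
  moreover have "N' = N" if "map_matrix of_int N' = Mmat \<beta> a b" for N' :: "int^3^3"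
    using that unfolding N[symmetric] by (simp add: vec_eq_iff)
  ultimately show ?thesis unfolding Mint_def by (metis (mono_tags, lifting) theI)
qed

definition U_dom :: "(complex \<times> complex) set" where
  "U_dom = {w. Im w > 0} \<times> UNIV"

text \<open>The generators are restricted to the domain because the elements of \<^term>\<open>BijGroup U_dom\<close> are
  extensional functions.\<close>

definition G_group ::
    "complex \<Rightarrow> real^3 \<Rightarrow> complex^3 \<Rightarrow> (complex \<times> complex \<Rightarrow> complex \<times> complex) set" where
  "G_group \<beta> a b = generate (BijGroup U_dom)
     (insert (restrict (\<lambda>(w, z). (complex_of_real (1 / (cmod \<beta>)\<^sup>2) * w, \<beta> * z)) U_dom)
        (range (\<lambda>i. restrict (\<lambda>(w, z). (w + complex_of_real (a $ i), z + b $ i)) U_dom)))"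

definition Inoue_surface ::
    "complex \<Rightarrow> real^3 \<Rightarrow> complex^3 \<Rightarrow> (complex \<times> complex) set complex_surface" where
  "Inoue_surface \<beta> a b = quot_surface U_dom (G_group \<beta> a b)"

definition Inoue_surfaces_I :: "(complex \<times> complex) set complex_surface set" where
  "Inoue_surfaces_I = {Inoue_surface \<beta> a b | \<beta> a b. admissible \<beta> \<and> compatible \<beta> a b}"

definition biholo_rel ::
    "((complex \<times> complex) set complex_surface \<times> (complex \<times> complex) set complex_surface) set" where
  "biholo_rel = {(X, Y). X \<in> Inoue_surfaces_I \<and> Y \<in> Inoue_surfaces_I \<and> biholomorphic X Y}"

end

theory Submission
  imports Defs "HOL-Complex_Analysis.Complex_Analysis"
begin

text \<open>A biholomorphism between two type I Inoue surfaces lifts to an equivariant automorphism \<open>F\<close> of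
  \<open>U = H \<times> \<complex>\<close>. By Liouville, the first component of \<open>F\<close> depends only on \<open>w\<close>, and since the translation
  lattice projects to a group of real translations with arbitrarily small elements, the derivative of
  that component has arbitrarily small periods, so the component is affine, \<open>\<kappa> w + \<mu>\<close>. Consequently \<open>F\<close>
  carries translations to translations and multiplication by \<open>\<kappa>\<close> identifies the two real translation
  modules, which yields the integral conjugation of the matrices. The \<open>z\<close>-derivative of the second
  component is invariant under the lattice, hence bounded on the sets of constant imaginary part of \<open>w\<close>,
  hence (again by Liouville and by small periods) a nonzero constant; comparing it along the dilation
  yields the equality of the two \<open>\<beta>\<close>. Conversely, conjugate matrices have proportional eigenvectors, and
  a diagonal linear map of \<open>U\<close> descends to the quotients.\<close>

section \<open>Quotients by free and properly discontinuous actions\<close>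

text \<open>Lifting is possible because \<open>U_dom\<close> is convex, hence simply connected;
  group elements are handled through the normal form \<open>aff k m\<close> (a power of the
  dilation, then a lattice translation). The small translations come from the dilation: the lattice
  of pairs (s m, t m) is stable under (\<alpha>, \<beta>) and its inverse, so s m can be shrunk by
  powers of 1/\<alpha>. The obstacle in the direct half is that an equivariant lift might send a
  translation to an element with a dilation part. Continuity excludes this for small translations,
  since the powers of \<alpha>' are isolated, and the resulting affine form of the first component
  excludes it for all. That component sees only \<alpha> and the matrices, which have both \<beta>
  and its conjugate as eigenvalues; so \<beta> is read off the second component c z + g(w), through
  c. Integer matrices are recovered from real numbers because s is injective on integer vectors. In
  the converse half a conjugating matrix scales the real eigenvector by a real factor that may be
  negative; the negative matrix then conjugates as well and gives a map preserving the half
  plane.\<close>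

lemma quot_proj_eq: "quot_proj U G x = {g x | g. g \<in> G}"
  by (simp add: quot_proj_def orbit_def)

lemma topspace_quot_topology [simp]: "topspace (quot_topology U G) = quot_space U G"
  using quotient_imp_surjective_map[OF quotient_map_quot_proj[of U G]] quot_proj_image[of U G]
  by auto

text \<open>Elements of G count only through their values on U, so the group axioms are pointwise
  there. \<open>act_disc\<close> gives freeness and evenly covered neighbourhoods at once: an
  element carrying one point of V into V acts trivially on all of U.\<close>

locale free_action =
  fixes U :: "'a::real_normed_vector set" and G :: "('a \<Rightarrow> 'a) set"
  assumes open_dom: "open U"
    and act_in: "g \<in> G \<Longrightarrow> x \<in> U \<Longrightarrow> g x \<in> U"
    and act_cont: "g \<in> G \<Longrightarrow> continuous_on U g"
    and act_id: "\<exists>e\<in>G. \<forall>x\<in>U. e x = x"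
    and act_comp: "g \<in> G \<Longrightarrow> h \<in> G \<Longrightarrow> \<exists>k\<in>G. \<forall>x\<in>U. k x = g (h x)"
    and act_inv: "g \<in> G \<Longrightarrow> \<exists>h\<in>G. \<forall>x\<in>U. h (g x) = x \<and> g (h x) = x"
    and act_disc: "x \<in> U \<Longrightarrow> \<exists>V. open V \<and> x \<in> V \<and> V \<subseteq> U \<and>
                     (\<forall>g\<in>G. \<forall>y\<in>V. g y \<in> V \<longrightarrow> (\<forall>z\<in>U. g z = z))"
begin

abbreviation q where "q \<equiv> quot_proj U G"

lemma q_eq_iff:
  assumes "x \<in> U" "y \<in> U"
  shows "q x = q y \<longleftrightarrow> (\<exists>g\<in>G. y = g x)"
proof
  assume "q x = q y"
  moreover have "y \<in> q y" using act_id assms by (metis (mono_tags, lifting) mem_Collect_eq quot_proj_eq)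
  ultimately show "\<exists>g\<in>G. y = g x" by (auto simp: quot_proj_eq)
next
  assume "\<exists>g\<in>G. y = g x"
  then obtain g where g: "g \<in> G" "y = g x" by blast
  obtain h where h: "h \<in> G" "\<forall>x\<in>U. h (g x) = x \<and> g (h x) = x" using act_inv g by blast
  have sub: "q v \<subseteq> q u" if "u \<in> U" "k \<in> G" "v = k u" for u v k
  proof
    fix z assume "z \<in> q v"
    then obtain l where l: "l \<in> G" "z = l v" unfolding quot_proj_eq by blast
    obtain j where "j \<in> G" "\<forall>x\<in>U. j x = l (k x)" using act_comp l(1) \<open>k \<in> G\<close> by blast
    then have "z = j u" using that l by simp
    with \<open>j \<in> G\<close> show "z \<in> q u" unfolding quot_proj_eq by blast
  qed
  have "x = h y" using g h assms by simp
  then show "q x = q y" using sub[OF assms(1) g(1,2)] sub[OF assms(2) h(1)] by blast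
qed

lemma q_act [simp]: "g \<in> G \<Longrightarrow> x \<in> U \<Longrightarrow> q (g x) = q x"
  using q_eq_iff act_in by blast

lemma continuous_map_q: "continuous_map (top_of_set U) (quot_topology U G) q"
  using quotient_map_quot_proj quotient_imp_continuous_map by blast

lemma open_act_preimage:
  assumes "g \<in> G" "open V"
  shows "open {p \<in> U. g p \<in> V}"
proof -
  have "open (U \<inter> g -` V)"
    using continuous_open_preimage[OF act_cont[OF assms(1)] open_dom assms(2)] .
  then show ?thesis by (simp add: Collect_conj_eq vimage_def)
qed

text \<open>The saturation of V is a union of preimages of V under group elements; this is what
  makes q an open map.\<close>

lemma q_image_preimage:
  assumes V: "V \<subseteq> U"
  shows "{p \<in> U. q p \<in> q ` V} = (\<Union>g\<in>G. {p \<in> U. g p \<in> V})"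
proof (intro subset_antisym subsetI)
  fix p assume "p \<in> {p \<in> U. q p \<in> q ` V}"
  then obtain v where "p \<in> U" "v \<in> V" "q p = q v" by blast
  with V obtain g where "g \<in> G" "v = g p" using q_eq_iff[of p v] by blast
  with \<open>p \<in> U\<close> \<open>v \<in> V\<close> show "p \<in> (\<Union>g\<in>G. {p \<in> U. g p \<in> V})" by blast
next
  fix p assume "p \<in> (\<Union>g\<in>G. {p \<in> U. g p \<in> V})"
  then obtain g where "g \<in> G" "p \<in> U" "g p \<in> V" by blast
  then have "q p = q (g p)" by simp
  with \<open>p \<in> U\<close> \<open>g p \<in> V\<close> show "p \<in> {p \<in> U. q p \<in> q ` V}" by blast
qed

lemma openin_q_image:
  assumes "open V" "V \<subseteq> U"
  shows "openin (quot_topology U G) (q ` V)"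
proof -
  have "open {p \<in> U. q p \<in> q ` V}"
    unfolding q_image_preimage[OF assms(2)] using open_act_preimage assms by blast
  moreover have "q ` V \<subseteq> quot_space U G" using image_mono[OF assms(2), of q] unfolding quot_proj_image .
  ultimately show ?thesis
    unfolding openin_quot_topology openin_open_eq[OF open_dom] by blast
qed

lemma sheet:
  assumes "x \<in> U"
  obtains V where "open V" "x \<in> V" "V \<subseteq> U" "inj_on q V"
    "\<And>g y. g \<in> G \<Longrightarrow> y \<in> V \<Longrightarrow> g y \<in> V \<Longrightarrow> \<forall>z\<in>U. g z = z"
proof -
  obtain V where V: "open V" "x \<in> V" "V \<subseteq> U" 
    "\<And>g y. g \<in> G \<Longrightarrow> y \<in> V \<Longrightarrow> g y \<in> V \<Longrightarrow> \<forall>z\<in>U. g z = z"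
    using act_disc[OF assms] by blast
  have "inj_on q V"
  proof
    fix y z assume yz: "y \<in> V" "z \<in> V" "q y = q z"
    then obtain g where "g \<in> G" "z = g y" using q_eq_iff V by blast
    then show "y = z" using V yz by (metis subsetD)
  qed
  then show thesis using that V by blast
qed

text \<open>The preimage of W is the preimage under \<phi> of the q-image of the intersection of V
  and W, by injectivity of q on V; that image is open because q is an open map.\<close>

lemma continuous_local_inverse:
  fixes \<phi> :: "'b::topological_space \<Rightarrow> 'a set"
  assumes \<phi>: "continuous_map (top_of_set S) (quot_topology U G) \<phi>"
    and V: "open V" "V \<subseteq> U" "inj_on q V"
    and T: "T = {y \<in> S. \<phi> y \<in> q ` V}"
  shows "continuous_on T (\<lambda>y. inv_into V q (\<phi> y))"
proof -
  have "openin (top_of_set T) (T \<inter> (\<lambda>y. inv_into V q (\<phi> y)) -` W)" if "open W" for W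
  proof -
    have "openin (top_of_set S) {y \<in> topspace (top_of_set S). \<phi> y \<in> q ` (V \<inter> W)}"
      using \<phi> openin_q_image[of "V \<inter> W"] V that
      by (intro openin_continuous_map_preimage) auto
    then obtain O' where O': "open O'" "{y \<in> S. \<phi> y \<in> q ` (V \<inter> W)} = S \<inter> O'"
      by (auto simp: openin_open)
    moreover have "T \<inter> (\<lambda>y. inv_into V q (\<phi> y)) -` W = {y \<in> S. \<phi> y \<in> q ` (V \<inter> W)}"
      using V by (auto simp: T)
    ultimately have "T \<inter> (\<lambda>y. inv_into V q (\<phi> y)) -` W = T \<inter> O'" 
      by (auto simp: T)
    then show ?thesis using O' by (auto simp: openin_open)
  qed
  then show ?thesis by (simp add: continuous_openin_preimage_eq)
qed

text \<open>The covering space theory of the library requires the base to be a subset of a normed space, which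
  the quotient is not. So a map \<open>\<phi>\<close> from \<open>S\<close> to the quotient is lifted by a section of the covering
  \<open>fst\<close> of \<open>S\<close> by the fibre product of \<open>\<phi>\<close> and \<open>q\<close>.\<close>

lemma lift_exists:
  fixes \<phi> :: "'b::real_normed_vector \<Rightarrow> 'a set"
  assumes \<phi>: "continuous_map (top_of_set S) (quot_topology U G) \<phi>"
    and S: "simply_connected S" "locally path_connected S"
  obtains F where "continuous_on S F" "F \<in> S \<rightarrow> U" "\<And>x. x \<in> S \<Longrightarrow> q (F x) = \<phi> x"
proof -
  define E where "E = {(x, p). x \<in> S \<and> p \<in> U \<and> q p = \<phi> x}"
  have \<phi>_in: "\<phi> x \<in> q ` U" if "x \<in> S" for x
    using continuous_map_image_subset_topspace[OF \<phi>] that by (auto simp: quot_proj_image)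
  have "covering_space E fst S"
  proof
    show "continuous_on E fst" by (intro continuous_intros)
    show "fst ` E = S"
    proof
      show "S \<subseteq> fst ` E"
      proof
        fix x assume "x \<in> S"
        then obtain p where "p \<in> U" "\<phi> x = q p" using \<phi>_in by blast
        with \<open>x \<in> S\<close> have "(x, p) \<in> E" by (simp add: E_def)
        then show "x \<in> fst ` E" by force
      qed
    qed (auto simp: E_def)
    fix x assume "x \<in> S"
    then obtain p where p: "p \<in> U" "\<phi> x = q p" using \<phi>_in by blast
    obtain V where V: "open V" "p \<in> V" "V \<subseteq> U" "inj_on q V"
      "\<And>g y. g \<in> G \<Longrightarrow> y \<in> V \<Longrightarrow> g y \<in> V \<Longrightarrow> \<forall>z\<in>U. g z = z"
      using sheet[OF p(1)] by metis
    define T where "T = {y \<in> S. \<phi> y \<in> q ` V}"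
    define s where "s = (\<lambda>y. inv_into V q (\<phi> y))"
    have s_in: "s y \<in> V" "q (s y) = \<phi> y" if "y \<in> T" for y
      using that by (auto simp: s_def T_def inv_into_into f_inv_into_f)
    have s_cont: "continuous_on T s"
      unfolding s_def by (rule continuous_local_inverse[OF \<phi> V(1,3,4) T_def])
    \<comment> \<open>\<open>u g\<close> is the graph of g after the local section s: the sheet of
      the covering indexed by g. Elements that agree on U index the same sheet.\<close>
    define u where "u = (\<lambda>g :: 'a \<Rightarrow> 'a. (\<lambda>y. (y, g (s y))) ` T)"
    have "openin (top_of_set S) {y \<in> topspace (top_of_set S). \<phi> y \<in> q ` V}"
      by (intro openin_continuous_map_preimage[OF \<phi>] openin_q_image V)
    then have T_open: "openin (top_of_set S) T" by (simp add: T_def)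
    have "x \<in> T" using \<open>x \<in> S\<close> p V by (auto simp: T_def)
    moreover have "\<exists>v. \<Union>v = E \<inter> fst -` T \<and> (\<forall>u\<in>v. openin (top_of_set E) u) \<and>
            pairwise disjnt v \<and> (\<forall>u\<in>v. \<exists>r. homeomorphism u T fst r)"
    proof (intro exI[of _ "u ` G"] conjI ballI)
      show "\<Union>(u ` G) = E \<inter> fst -` T"
      proof
        show "\<Union>(u ` G) \<subseteq> E \<inter> fst -` T"
        proof clarify
          fix g y r assume "g \<in> G" "(y, r) \<in> u g"
          then have "y \<in> T" "r = g (s y)" by (auto simp: u_def)
          moreover have "s y \<in> U" using s_in \<open>y \<in> T\<close> V by blast
          ultimately show "(y, r) \<in> E \<inter> fst -` T"
            using \<open>g \<in> G\<close> act_in s_in by (auto simp: E_def T_def)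
        qed
        show "E \<inter> fst -` T \<subseteq> \<Union>(u ` G)"
        proof clarify
          fix y r assume "(y, r) \<in> E" "fst (y, r) \<in> T"
          then have y: "y \<in> T" "r \<in> U" "q r = \<phi> y" by (auto simp: E_def)
          then have "q (s y) = q r" "s y \<in> U" using s_in V by auto
          then obtain g where "g \<in> G" "r = g (s y)" using q_eq_iff y by blast
          with y show "(y, r) \<in> \<Union>(u ` G)" by (auto simp: u_def)
        qed
      qed
    next
      fix w assume "w \<in> u ` G"
      then obtain g where g: "g \<in> G" "w = u g" by blast
      obtain h where h: "h \<in> G" "\<forall>x\<in>U. h (g x) = x \<and> g (h x) = x" using act_inv g by blast
      obtain S' where S': "open S'" "T = S \<inter> S'" using T_open by (auto simp: openin_open)
      \<comment> \<open>Openness of the sheet: over \<open>S'\<close> it is cut out of E by the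
        condition that the inverse h of g brings the second coordinate back into V.\<close>
      have eq: "w = E \<inter> (S' \<times> {r \<in> U. h r \<in> V})"
      proof
        show "w \<subseteq> E \<inter> (S' \<times> {r \<in> U. h r \<in> V})"
        proof
          fix z assume "z \<in> w"
          then obtain y where y: "y \<in> T" "z = (y, g (s y))" using g by (auto simp: u_def)
          have "s y \<in> U" using s_in y V by blast
          then show "z \<in> E \<inter> (S' \<times> {r \<in> U. h r \<in> V})"
            using y s_in[OF y(1)] S' g h act_in by (auto simp: E_def)
        qed
        show "E \<inter> (S' \<times> {r \<in> U. h r \<in> V}) \<subseteq> w"
        proof clarify
          fix y r assume yr: "(y, r) \<in> E" "y \<in> S'" "r \<in> U" "h r \<in> V"
          then have y: "y \<in> T" "q r = \<phi> y" using S' by (auto simp: E_def)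
          then have "q (h r) = q (s y)" using s_in h yr by simp
          then have "h r = s y" using V(4) yr(4) s_in[OF y(1)] by (auto dest: inj_onD)
          then have "r = g (s y)" using h yr by metis
          then show "(y, r) \<in> w" using y g by (auto simp: u_def)
        qed
      qed
      show "openin (top_of_set E) w"
        unfolding eq by (intro openin_open_Int open_Times S' open_act_preimage h V)
      show "\<exists>r. homeomorphism w T fst r"
      proof (intro exI homeomorphismI)
        show "continuous_on w fst" by (intro continuous_intros)
        have "s ` T \<subseteq> U" using s_in V by blast
        then show "continuous_on T (\<lambda>y. (y, g (s y)))"
          using act_cont[OF g(1)] s_cont
          by (intro continuous_intros continuous_on_compose2[of U g T s]) auto
      qed (auto simp: g u_def)
    next
      show "pairwise disjnt (u ` G)"
      proof (clarsimp simp: pairwise_def)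
        fix g h assume gh: "g \<in> G" "h \<in> G" "u g \<noteq> u h"
        show "disjnt (u g) (u h)"
        proof (rule ccontr)
          assume "\<not> ?thesis"
          then obtain y where y: "y \<in> T" "g (s y) = h (s y)"
            by (auto simp: disjnt_iff u_def)
          obtain h' where h': "h' \<in> G" "\<forall>x\<in>U. h' (h x) = x \<and> h (h' x) = x"
            using act_inv gh by blast
          \<comment> \<open>k is g followed by the inverse of h. It fixes the point s y of V, so it
            acts trivially on U, and g and h agree there.\<close>
          obtain k where k: "k \<in> G" "\<forall>x\<in>U. k x = h' (g x)" using act_comp h' gh by blast
          have "s y \<in> V" "s y \<in> U" using s_in y V by auto
          then have "k (s y) \<in> V" using k h' y by simp
          then have "\<forall>z\<in>U. k z = z" using V(5) k \<open>s y \<in> V\<close> by blast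
          then have "g z = h z" if "z \<in> U" for z
            using that k h' act_in gh by metis
          then have "u g = u h" using s_in V by (auto simp: u_def image_iff) (metis subsetD)+
          with gh show False by simp
        qed
      qed
    qed
    ultimately show "\<exists>T. x \<in> T \<and> openin (top_of_set S) T \<and>
          (\<exists>v. \<Union>v = E \<inter> fst -` T \<and> (\<forall>u\<in>v. openin (top_of_set E) u) \<and>
            pairwise disjnt v \<and> (\<forall>u\<in>v. \<exists>r. homeomorphism u T fst r))"
      using T_open by blast
  qed
  then obtain g where g: "continuous_on S g" "g \<in> S \<rightarrow> E" "\<And>y. y \<in> S \<Longrightarrow> fst (g y) = y"
    using covering_space_lift[of E fst S S "\<lambda>x. x"] S by (auto intro: continuous_on_id)
  show thesis
  proof (rule that[of "\<lambda>x. snd (g x)"])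
    show "continuous_on S (\<lambda>x. snd (g x))" using g by (intro continuous_intros)
  next
    have "g x \<in> E" "fst (g x) = x" if "x \<in> S" for x using g that by auto
    then show "(\<lambda>x. snd (g x)) \<in> S \<rightarrow> U" "\<And>x. x \<in> S \<Longrightarrow> q (snd (g x)) = \<phi> x"
      by (force simp: E_def split: prod.splits)+
  qed
qed

text \<open>The set where A agrees with g after B is closed by continuity. It is open because near A
  x both maps stay in a neighbourhood V as in \<open>sheet\<close>, where points of one orbit
  coincide.\<close>

lemma lift_unique:
  fixes A B :: "'b::topological_space \<Rightarrow> 'a"
  assumes S: "connected S" "S \<noteq> {}"
    and A: "continuous_on S A" "A \<in> S \<rightarrow> U" and B: "continuous_on S B" "B \<in> S \<rightarrow> U"
    and AB: "\<And>x. x \<in> S \<Longrightarrow> q (A x) = q (B x)"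
  obtains g where "g \<in> G" "\<And>x. x \<in> S \<Longrightarrow> A x = g (B x)"
proof -
  obtain x0 where "x0 \<in> S" using S by blast
  have "A x \<in> U" "B x \<in> U" if "x \<in> S" for x using A B that by auto
  note in_U = this
  obtain g where g: "g \<in> G" "A x0 = g (B x0)"
    using q_eq_iff[of "B x0" "A x0"] AB \<open>x0 \<in> S\<close> in_U by metis
  define Z where "Z = {x \<in> S. A x = g (B x)}"
  have gB: "continuous_on S (\<lambda>x. g (B x))"
    using continuous_on_compose2[OF act_cont[OF g(1)] B(1)] in_U by blast
  have "closedin (top_of_set S) Z"
    using continuous_closedin_preimage_constant[OF continuous_on_diff[OF A(1) gB], of 0]
    by (simp add: Z_def)
  moreover have "openin (top_of_set S) Z"
  proof (subst openin_subopen, clarify)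
    fix x assume "x \<in> Z"
    then have x: "x \<in> S" "A x = g (B x)" by (auto simp: Z_def)
    obtain V where V: "open V" "A x \<in> V" "V \<subseteq> U" 
      "\<And>g y. g \<in> G \<Longrightarrow> y \<in> V \<Longrightarrow> g y \<in> V \<Longrightarrow> \<forall>z\<in>U. g z = z"
      using sheet[OF in_U(1)[OF x(1)]] by metis
    let ?T = "(S \<inter> A -` V) \<inter> (S \<inter> (\<lambda>x. g (B x)) -` V)"
    have "openin (top_of_set S) ?T"
      by (intro openin_Int continuous_openin_preimage_gen A gB V)
    moreover have "x \<in> ?T" using x V by auto
    moreover have "?T \<subseteq> Z"
    proof
      fix y assume "y \<in> ?T"
      then have y: "y \<in> S" "A y \<in> V" "g (B y) \<in> V" by auto
      have "q (A y) = q (g (B y))" using AB y g in_U by simp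
      then obtain k where "k \<in> G" "A y = k (g (B y))"
        using q_eq_iff[of "g (B y)" "A y"] in_U y act_in g by metis
      then show "y \<in> Z" using V y by (metis (mono_tags, lifting) Z_def mem_Collect_eq subsetD)
    qed
    ultimately show "\<exists>T. openin (top_of_set S) T \<and> x \<in> T \<and> T \<subseteq> Z" by blast
  qed
  moreover have "Z \<noteq> {}" using g \<open>x0 \<in> S\<close> by (auto simp: Z_def)
  ultimately have "Z = S" using S connected_clopen by blast
  then show thesis using that g by (auto simp: Z_def)
qed

end

section \<open>Holomorphic maps between quotients\<close>

lemma holomorphic2_on_open:
  assumes "open S"
  shows "holomorphic2_on f S \<longleftrightarrow>
    (\<forall>p\<in>S. \<exists>D. (f has_derivative D) (at p) \<and> (\<forall>c v. D (cscale c v) = cscale c (D v)))"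
  unfolding holomorphic2_on_def using at_within_open[OF _ assms] by simp

lemma holomorphic2_on_imp_continuous_on: "holomorphic2_on f S \<Longrightarrow> continuous_on S f"
  unfolding holomorphic2_on_def continuous_on_eq_continuous_within
  using has_derivative_continuous by blast

lemma holomorphic2_on_compose:
  assumes "open S" "open T" "holomorphic2_on f S" "holomorphic2_on g T" "f \<in> S \<rightarrow> T"
  shows "holomorphic2_on (\<lambda>x. g (f x)) S"
  unfolding holomorphic2_on_open[OF assms(1)]
proof
  fix p assume p: "p \<in> S"
  obtain D where D: "(f has_derivative D) (at p)" "\<And>c v. D (cscale c v) = cscale c (D v)"
    using assms(3) p unfolding holomorphic2_on_open[OF assms(1)] by blast
  have "f p \<in> T" using assms(5) p by blast
  then obtain E where E: "(g has_derivative E) (at (f p))" "\<And>c v. E (cscale c v) = cscale c (E v)"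
    using assms(4) unfolding holomorphic2_on_open[OF assms(2)] by blast
  have "((\<lambda>x. g (f x)) has_derivative (\<lambda>x. E (D x))) (at p)"
    using has_derivative_compose[OF D(1) E(1)] .
  then show "\<exists>D. ((\<lambda>x. g (f x)) has_derivative D) (at p) \<and> (\<forall>c v. D (cscale c v) = cscale c (D v))"
    using D(2) E(2) by (intro exI[of _ "\<lambda>x. E (D x)"]) simp
qed

lemma holomorphic2_onI_local:
  assumes "open S"
    and "\<And>p. p \<in> S \<Longrightarrow> \<exists>N g. open N \<and> p \<in> N \<and> holomorphic2_on g N \<and> (\<forall>x\<in>N. g x = f x)"
  shows "holomorphic2_on f S"
  unfolding holomorphic2_on_open[OF assms(1)]
proof
  fix p assume "p \<in> S"
  from assms(2)[OF this]
  obtain N g where N: "open N" "p \<in> N" "holomorphic2_on g N" "\<And>x. x \<in> N \<Longrightarrow> g x = f x"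
    by metis
  then obtain D where D: "(g has_derivative D) (at p)" "\<forall>c v. D (cscale c v) = cscale c (D v)"
    using holomorphic2_on_open by metis
  have "(f has_derivative D) (at p)"
    using has_derivative_transform_within_open[OF D(1) N(1,2,4)] .
  with D(2) show "\<exists>D. (f has_derivative D) (at p) \<and> (\<forall>c v. D (cscale c v) = cscale c (D v))"
    by (intro exI conjI)
qed

lemma holomorphic2_on_cong:
  assumes "\<And>x. x \<in> S \<Longrightarrow> f x = g x"
  shows "holomorphic2_on f S \<longleftrightarrow> holomorphic2_on g S"
proof -
  have "(f has_derivative D) (at p within S) \<longleftrightarrow> (g has_derivative D) (at p within S)" if "p \<in> S" for p D
    using has_derivative_transform[OF that, of f g D] has_derivative_transform[OF that, of g f D] assms
    by auto
  then show ?thesis by (simp add: holomorphic2_on_def)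
qed

lemma holomorphic2_on_subset: "holomorphic2_on f S \<Longrightarrow> T \<subseteq> S \<Longrightarrow> holomorphic2_on f T"
  unfolding holomorphic2_on_def by (meson has_derivative_subset subsetD)

locale holo_action = free_action U G for U :: "(complex \<times> complex) set" and G +
  assumes act_holo: "g \<in> G \<Longrightarrow> holomorphic2_on g U"

lemma ball_atlas_quot_surface:
  "(\<forall>(V, \<phi>)\<in>atlas (quot_surface U G). P V \<phi>) \<longleftrightarrow>
     (\<forall>V. open V \<and> V \<subseteq> U \<and> inj_on (quot_proj U G) V \<longrightarrow>
        P (quot_proj U G ` V) (inv_into V (quot_proj U G)))"
  by (simp add: quot_surface_def setcompr_eq_image)

text \<open>The inverse of a chart is the projection itself, so the coordinate expression of f
  becomes a local inverse of the target projection after f after the source projection.\<close>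

lemma holomorphic_map_quot_surface:
  "holomorphic_map (quot_surface U G) (quot_surface U' G') f \<longleftrightarrow>
     continuous_map (quot_topology U G) (quot_topology U' G') f \<and>
     (\<forall>V W. open V \<and> V \<subseteq> U \<and> inj_on (quot_proj U G) V \<and>
            open W \<and> W \<subseteq> U' \<and> inj_on (quot_proj U' G') W \<longrightarrow>
        holomorphic2_on (\<lambda>p. inv_into W (quot_proj U' G') (f (quot_proj U G p)))
          {p \<in> V. f (quot_proj U G p) \<in> quot_proj U' G' ` W})"
proof -
  have "holomorphic2_on (inv_into W (quot_proj U' G') \<circ> f \<circ>
             inv_into (quot_proj U G ` V) (inv_into V (quot_proj U G)))
           (inv_into V (quot_proj U G) ` {x \<in> quot_proj U G ` V. f x \<in> quot_proj U' G' ` W}) \<longleftrightarrow>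
        holomorphic2_on (\<lambda>p. inv_into W (quot_proj U' G') (f (quot_proj U G p)))
          {p \<in> V. f (quot_proj U G p) \<in> quot_proj U' G' ` W}"
    if inj: "inj_on (quot_proj U G) V" for V W
  proof -
    let ?q = "quot_proj U G"
    have inv: "inv_into (?q ` V) (inv_into V ?q) p = ?q p" if "p \<in> V" for p
    proof (rule inv_into_f_eq)
      show "inj_on (inv_into V ?q) (?q ` V)" by (simp add: inj_on_inv_into)
    qed (use that inj in auto)
    have set_eq: "inv_into V ?q ` {x \<in> ?q ` V. f x \<in> quot_proj U' G' ` W}
        = {p \<in> V. f (?q p) \<in> quot_proj U' G' ` W}" (is "?L = ?R")
    proof
      show "?L \<subseteq> ?R" using inj by auto
      show "?R \<subseteq> ?L"
      proof
        fix p assume p: "p \<in> ?R"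
        then have "p = inv_into V ?q (?q p)" using inj by simp
        with p show "p \<in> ?L" by blast
      qed
    qed
    show ?thesis
      unfolding set_eq by (rule holomorphic2_on_cong) (simp add: inv)
  qed
  then show ?thesis
    unfolding holomorphic_map_def ball_atlas_quot_surface by (simp add: quot_surface_def) blast
qed

context
  fixes U G U' G' F f
  assumes A: "holo_action U G" and B: "holo_action U' G'"
    and F: "continuous_on U F" "F \<in> U \<rightarrow> U'"
    and f: "\<And>p. p \<in> U \<Longrightarrow> f (quot_proj U G p) = quot_proj U' G' (F p)"
begin

interpretation A: holo_action U G by (rule A)
interpretation B: holo_action U' G' by (rule B)

lemma continuous_map_induced: "continuous_map (quot_topology U G) (quot_topology U' G') f"
proof -
  have "continuous_map (top_of_set U) (top_of_set U') F" using F by auto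
  then have "continuous_map (top_of_set U) (quot_topology U' G') (B.q \<circ> F)"
    using B.continuous_map_q continuous_map_compose by blast
  then have "continuous_map (top_of_set U) (quot_topology U' G') (f \<circ> A.q)"
    by (rule continuous_map_eq) (simp add: f)
  then show ?thesis
    using continuous_compose_quotient_map_eq[OF quotient_map_quot_proj[of U G]] by blast
qed

text \<open>In one direction V is shrunk until F maps it into W, so that the coordinate expression
  of f is F; in the other direction it is locally F followed by the element of G' that moves F p
  into W.\<close>

lemma holomorphic_induced_iff:
  "holomorphic_map (quot_surface U G) (quot_surface U' G') f \<longleftrightarrow> holomorphic2_on F U"
proof
  assume "holomorphic_map (quot_surface U G) (quot_surface U' G') f"
  then have hol: "holomorphic2_on (\<lambda>p. inv_into W B.q (f (A.q p))) {p \<in> V. f (A.q p) \<in> B.q ` W}"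
    if "open V" "V \<subseteq> U" "inj_on A.q V" "open W" "W \<subseteq> U'" "inj_on B.q W" for V W
    using that by (auto simp: holomorphic_map_quot_surface)
  show "holomorphic2_on F U"
  proof (rule holomorphic2_onI_local[OF A.open_dom])
    fix p assume p: "p \<in> U"
    then have "F p \<in> U'" using F by blast
    obtain V where V: "open V" "p \<in> V" "V \<subseteq> U" "inj_on A.q V" using A.sheet[OF p] by metis
    obtain W where W: "open W" "F p \<in> W" "W \<subseteq> U'" "inj_on B.q W"
      using B.sheet[OF \<open>F p \<in> U'\<close>] by metis
    define N where "N = V \<inter> (U \<inter> F -` W)"
    have N: "open N" "N \<subseteq> V" "p \<in> N"
      unfolding N_def using V W p continuous_open_preimage[OF F(1) A.open_dom W(1)] by auto
    have "inj_on A.q N" using V N inj_on_subset by blast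
    then have "holomorphic2_on (\<lambda>p. inv_into W B.q (f (A.q p))) {p \<in> N. f (A.q p) \<in> B.q ` W}"
      using hol[of N W] V W N by auto
    moreover have "{p \<in> N. f (A.q p) \<in> B.q ` W} = N"
      using f V by (auto simp: N_def)
    moreover have "inv_into W B.q (f (A.q x)) = F x" if "x \<in> N" for x
      using that f V W by (auto simp: N_def)
    ultimately show "\<exists>N g. open N \<and> p \<in> N \<and> holomorphic2_on g N \<and> (\<forall>x\<in>N. g x = F x)"
      using N by (metis (no_types, lifting))
  qed
next
  assume hol: "holomorphic2_on F U"
  have "holomorphic2_on (\<lambda>p. inv_into W B.q (f (A.q p))) {p \<in> V. f (A.q p) \<in> B.q ` W}"
    if VW: "open V" "V \<subseteq> U" "inj_on A.q V" "open W" "W \<subseteq> U'" "inj_on B.q W" for V W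
  proof (rule holomorphic2_onI_local)
    let ?N = "{p \<in> V. f (A.q p) \<in> B.q ` W}"
    have "open {p \<in> U'. B.q p \<in> B.q ` W}"
      unfolding B.q_image_preimage[OF VW(5)] using B.open_act_preimage[OF _ VW(4)] by blast
    from continuous_open_preimage[OF F(1) A.open_dom this]
    have "open (V \<inter> (U \<inter> F -` {p \<in> U'. B.q p \<in> B.q ` W}))" using VW by blast
    moreover have "V \<inter> (U \<inter> F -` {p \<in> U'. B.q p \<in> B.q ` W}) = ?N"
      using VW F f by auto
    ultimately show N: "open ?N" by simp
    fix p assume p: "p \<in> ?N"
    then have "p \<in> U" "F p \<in> U'" using VW F by auto
    then obtain r where "r \<in> W" "B.q (F p) = B.q r" using p f by auto
    then obtain g where g: "g \<in> G'" "r = g (F p)"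
      using B.q_eq_iff[of "F p" r] VW \<open>F p \<in> U'\<close> by blast
    have gF: "holomorphic2_on (\<lambda>x. g (F x)) U"
      by (rule holomorphic2_on_compose[OF A.open_dom B.open_dom hol B.act_holo[OF g(1)] F(2)])
    define N' where "N' = ?N \<inter> (U \<inter> (\<lambda>x. g (F x)) -` W)"
    have "open N'"
      unfolding N'_def
      by (intro open_Int N continuous_open_preimage[OF _ A.open_dom VW(4)] 
          holomorphic2_on_imp_continuous_on gF)
    moreover have "p \<in> N'" using p g \<open>r \<in> W\<close> \<open>p \<in> U\<close> by (simp add: N'_def)
    moreover have "holomorphic2_on (\<lambda>x. g (F x)) N'"
      by (rule holomorphic2_on_subset[OF gF]) (auto simp: N'_def)
    moreover have "g (F x) = inv_into W B.q (f (A.q x))" if "x \<in> N'" for x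
    proof -
      have "x \<in> U" "g (F x) \<in> W" "F x \<in> U'" using that F by (auto simp: N'_def)
      then have "f (A.q x) = B.q (g (F x))" using f g by simp
      then show ?thesis using \<open>g (F x) \<in> W\<close> VW(6) by simp
    qed
    ultimately show "\<exists>N g. open N \<and> p \<in> N \<and> holomorphic2_on g N \<and>
        (\<forall>x\<in>N. g x = inv_into W B.q (f (A.q x)))" by blast
  qed
  then show "holomorphic_map (quot_surface U G) (quot_surface U' G') f"
    by (auto simp: holomorphic_map_quot_surface continuous_map_induced)
qed

end

lemma biholomorphic_quotI:
  assumes A: "holo_action U G" and B: "holo_action U' G'"
    and F: "holomorphic2_on F U" "F \<in> U \<rightarrow> U'" and H: "holomorphic2_on H U'" "H \<in> U' \<rightarrow> U"
    and HF: "\<And>x. x \<in> U \<Longrightarrow> H (F x) = x" and FH: "\<And>x. x \<in> U' \<Longrightarrow> F (H x) = x"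
    and eqv: "\<And>g x. g \<in> G \<Longrightarrow> x \<in> U \<Longrightarrow> \<exists>g'\<in>G'. F (g x) = g' (F x)"
    and eqv': "\<And>g x. g \<in> G' \<Longrightarrow> x \<in> U' \<Longrightarrow> \<exists>g'\<in>G. H (g x) = g' (H x)"
  shows "biholomorphic (quot_surface U G) (quot_surface U' G')"
proof -
  interpret A: holo_action U G by (rule A)
  interpret B: holo_action U' G' by (rule B)
  \<comment> \<open>A union avoids choosing representatives: by equivariance the orbits of F x
    coincide for all x in one orbit, so the union is a single orbit.\<close>
  define f where "f = (\<lambda>X. \<Union>x\<in>X. B.q (F x))"
  define h where "h = (\<lambda>X. \<Union>x\<in>X. A.q (H x))"
  have Fq: "B.q (F (g x)) = B.q (F x)" if "g \<in> G" "x \<in> U" for g x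
    using eqv[OF that] F(2) that by (auto dest!: funcset_mem)
  have Hq: "A.q (H (g x)) = A.q (H x)" if "g \<in> G'" "x \<in> U'" for g x
    using eqv'[OF that] H(2) that by (auto dest!: funcset_mem)
  have f: "f (A.q x) = B.q (F x)" if "x \<in> U" for x
  proof -
    have "f (A.q x) = (\<Union>g\<in>G. B.q (F (g x)))" by (auto simp: f_def quot_proj_eq[of U G])
    moreover have "G \<noteq> {}" using A.act_id by blast
    ultimately show ?thesis using Fq that by simp
  qed
  have h: "h (B.q x) = A.q (H x)" if "x \<in> U'" for x
  proof -
    have "h (B.q x) = (\<Union>g\<in>G'. A.q (H (g x)))" by (auto simp: h_def quot_proj_eq[of U' G'])
    moreover have "G' \<noteq> {}" using B.act_id by blast
    ultimately show ?thesis using Hq that by simp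
  qed
  note cF = holomorphic2_on_imp_continuous_on[OF F(1)] and cH = holomorphic2_on_imp_continuous_on[OF H(1)]
  have "homeomorphic_maps (quot_topology U G) (quot_topology U' G') f h"
    unfolding homeomorphic_maps_def
  proof (intro conjI ballI)
    show "continuous_map (quot_topology U G) (quot_topology U' G') f"
      using continuous_map_induced[OF A B cF F(2)] f by blast
    show "continuous_map (quot_topology U' G') (quot_topology U G) h"
      using continuous_map_induced[OF B A cH H(2)] h by blast
    fix X assume "X \<in> topspace (quot_topology U G)"
    then obtain x where "x \<in> U" "X = A.q x" unfolding topspace_quot_topology quot_proj_image[symmetric] by blast
    moreover from this have "F x \<in> U'" using F by blast
    ultimately show "h (f X) = X" using f h HF by simp
  next
    fix X assume "X \<in> topspace (quot_topology U' G')"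
    then obtain x where "x \<in> U'" "X = B.q x" unfolding topspace_quot_topology quot_proj_image[symmetric] by blast
    moreover from this have "H x \<in> U" using H by blast
    ultimately show "f (h X) = X" using f h FH by simp
  qed
  moreover have "holomorphic_map (quot_surface U G) (quot_surface U' G') f"
    using holomorphic_induced_iff[OF A B cF F(2)] f F by blast
  moreover have "holomorphic_map (quot_surface U' G') (quot_surface U G) h"
    using holomorphic_induced_iff[OF B A cH H(2)] h H by blast
  ultimately show ?thesis
    by (auto simp: biholomorphic_def quot_surface_def)
qed

text \<open>f and its inverse h lift to F and K. K after F lifts the identity, hence is an element k
  of G, and correcting K by the inverse of k gives H with H (F x) = x. Equivariance holds because F
  and F after g lift the same map.\<close>

lemma biholomorphic_quotE:
  assumes A: "holo_action U G" and B: "holo_action U' G'"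
    and U: "simply_connected U" "U \<noteq> {}" and U': "simply_connected U'" "U' \<noteq> {}"
    and bihol: "biholomorphic (quot_surface U G) (quot_surface U' G')"
  obtains F H where "holomorphic2_on F U" "F \<in> U \<rightarrow> U'" "holomorphic2_on H U'" "H \<in> U' \<rightarrow> U"
    "\<And>x. x \<in> U \<Longrightarrow> H (F x) = x" "\<And>x. x \<in> U' \<Longrightarrow> F (H x) = x"
    "\<And>g. g \<in> G \<Longrightarrow> \<exists>g'\<in>G'. \<forall>x\<in>U. F (g x) = g' (F x)"
    "\<And>g. g \<in> G' \<Longrightarrow> \<exists>g'\<in>G. \<forall>x\<in>U'. H (g x) = g' (H x)"
proof -
  interpret A: holo_action U G by (rule A)
  interpret B: holo_action U' G' by (rule B)
  obtain f h where "homeomorphic_maps (quot_topology U G) (quot_topology U' G') f h"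
    and hol: "holomorphic_map (quot_surface U G) (quot_surface U' G') f"
        "holomorphic_map (quot_surface U' G') (quot_surface U G) h"
    using bihol by (auto simp: biholomorphic_def quot_surface_def)
  then have cf: "continuous_map (quot_topology U G) (quot_topology U' G') f"
    and ch: "continuous_map (quot_topology U' G') (quot_topology U G) h"
    and hf: "\<And>X. X \<in> quot_space U G \<Longrightarrow> h (f X) = X"
    and fh: "\<And>X. X \<in> quot_space U' G' \<Longrightarrow> f (h X) = X"
    by (auto simp: homeomorphic_maps_def)
  have qin: "A.q x \<in> quot_space U G" if "x \<in> U" for x using that quot_proj_image[of U G] by blast
  have qin': "B.q x \<in> quot_space U' G'" if "x \<in> U'" for x using that quot_proj_image[of U' G'] by blast
  note conn = simply_connected_imp_connected[OF U(1)] simply_connected_imp_connected[OF U'(1)]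
  have "continuous_map (top_of_set U) (quot_topology U' G') (\<lambda>x. f (A.q x))"
    using continuous_map_compose[OF A.continuous_map_q cf] by (simp add: o_def)
  from B.lift_exists[OF this U(1) open_imp_locally_path_connected[OF A.open_dom]]
  obtain F where F: "continuous_on U F" "F \<in> U \<rightarrow> U'" "\<And>x. x \<in> U \<Longrightarrow> B.q (F x) = f (A.q x)" by blast
  have "continuous_map (top_of_set U') (quot_topology U G) (\<lambda>x. h (B.q x))"
    using continuous_map_compose[OF B.continuous_map_q ch] by (simp add: o_def)
  from A.lift_exists[OF this U'(1) open_imp_locally_path_connected[OF B.open_dom]]
  obtain K where K: "continuous_on U' K" "K \<in> U' \<rightarrow> U" "\<And>x. x \<in> U' \<Longrightarrow> A.q (K x) = h (B.q x)" by blast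
  have FU: "F x \<in> U'" if "x \<in> U" for x using F that by blast
  have KU: "K x \<in> U" if "x \<in> U'" for x using K that by blast
  have cKF: "continuous_on U (\<lambda>x. K (F x))" using continuous_on_compose2[OF K(1) F(1)] FU by blast
  have KF: "A.q (K (F x)) = A.q x" if "x \<in> U" for x
    using K F FU hf qin that by simp
  obtain k where k: "k \<in> G" "\<And>x. x \<in> U \<Longrightarrow> K (F x) = k x"
    using A.lift_unique[OF conn(1) U(2) cKF _ continuous_on_id _ KF] FU KU by auto
  obtain k' where k': "k' \<in> G" "\<forall>x\<in>U. k' (k x) = x \<and> k (k' x) = x" using A.act_inv k by blast
  define H where "H = (\<lambda>x. k' (K x))"
  have H: "continuous_on U' H"
    unfolding H_def by (rule continuous_on_compose2[OF A.act_cont[OF k'(1)] K(1)]) (use KU in blast)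
  have HU: "H x \<in> U" if "x \<in> U'" for x using A.act_in[OF k'(1) KU[OF that]] by (simp add: H_def)
  then have H': "H \<in> U' \<rightarrow> U" by blast
  have HF: "H (F x) = x" if "x \<in> U" for x using that k k' by (simp add: H_def)
  have Hq: "A.q (H x) = h (B.q x)" if "x \<in> U'" for x using that K KU k' by (simp add: H_def)
  have cFH: "continuous_on U' (\<lambda>x. F (H x))" using continuous_on_compose2[OF F(1) H] HU by blast
  have qFH: "B.q (F (H x)) = B.q x" if "x \<in> U'" for x
    using F HU Hq fh qin' that by simp
  obtain l where l: "l \<in> G'" "\<And>x. x \<in> U' \<Longrightarrow> F (H x) = l x"
    using B.lift_unique[OF conn(2) U'(2) cFH _ continuous_on_id _ qFH] FU HU by auto
  \<comment> \<open>F after H is the element l, hence onto, and it is idempotent because H undoes F;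
    so it is the identity.\<close>
  have FH: "F (H x) = x" if "x \<in> U'" for x
  proof -
    obtain l' where l': "l' \<in> G'" "\<forall>x\<in>U'. l' (l x) = x \<and> l (l' x) = x" using B.act_inv l by blast
    define y where "y = l' x"
    have "y \<in> U'" using l' B.act_in that by (simp add: y_def)
    have "x = F (H y)" using l l' that \<open>y \<in> U'\<close> by (simp add: y_def)
    then show ?thesis using HF HU \<open>y \<in> U'\<close> by simp
  qed
  show thesis
  proof (rule that[OF _ F(2) _ H' HF FH])
    show "holomorphic2_on F U" using holomorphic_induced_iff[OF A B F(1,2)] F hol by simp
    show "holomorphic2_on H U'" using holomorphic_induced_iff[OF B A H H'] Hq hol by simp
  next
    fix g assume g: "g \<in> G"
    have "continuous_on U (\<lambda>x. F (g x))"
      using continuous_on_compose2[OF F(1) A.act_cont[OF g]] A.act_in g by blast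
    moreover have "B.q (F (g x)) = B.q (F x)" if "x \<in> U" for x using F(3) that A.act_in g by simp
    ultimately obtain g' where "g' \<in> G'" "\<And>x. x \<in> U \<Longrightarrow> F (g x) = g' (F x)"
      using B.lift_unique[OF conn(1) U(2) _ _ F(1,2), of "\<lambda>x. F (g x)"] A.act_in g FU by blast
    then show "\<exists>g'\<in>G'. \<forall>x\<in>U. F (g x) = g' (F x)" by blast
  next
    fix g assume g: "g \<in> G'"
    have "continuous_on U' (\<lambda>x. H (g x))"
      using continuous_on_compose2[OF H B.act_cont[OF g]] B.act_in g by blast
    moreover have "A.q (H (g x)) = A.q (H x)" if "x \<in> U'" for x using Hq that B.act_in g by simp
    ultimately obtain g' where "g' \<in> G" "\<And>x. x \<in> U' \<Longrightarrow> H (g x) = g' (H x)"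
      using A.lift_unique[OF conn(2) U'(2) _ _ H H', of "\<lambda>x. H (g x)"] B.act_in g HU by blast
    then show "\<exists>g'\<in>G. \<forall>x\<in>U'. H (g x) = g' (H x)" by blast
  qed
qed

section \<open>Eigenbases of three-dimensional matrices\<close>

lemma distinct_independent_3:
  fixes u v w :: "'a::field^'n"
  shows "distinct [u, v, w] \<and> vec.independent {u, v, w} \<longleftrightarrow>
    (\<forall>x y z. x *s u + y *s v + z *s w = 0 \<longrightarrow> x = 0 \<and> y = 0 \<and> z = 0)"
proof
  assume L: "distinct [u, v, w] \<and> vec.independent {u, v, w}"
  show "\<forall>x y z. x *s u + y *s v + z *s w = 0 \<longrightarrow> x = 0 \<and> y = 0 \<and> z = 0"
  proof (intro allI impI)
    fix x y z assume eq: "x *s u + y *s v + z *s w = 0"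
    define c where "c = (\<lambda>p. if p = u then x else if p = v then y else z)"
    have "(\<Sum>p\<in>{u, v, w}. c p *s p) = x *s u + y *s v + z *s w"
      using L by (auto simp: c_def add.assoc)
    with eq have "(\<Sum>p\<in>{u, v, w}. c p *s p) = 0" by simp
    then have "\<forall>p\<in>{u, v, w}. c p = 0"
      using L unfolding vec.dependent_finite[OF finite.intros(2)[OF finite.intros(2)[OF finite.intros(2)[OF finite.intros(1)]]]]
      by blast
    then show "x = 0 \<and> y = 0 \<and> z = 0" using L by (auto simp: c_def split: if_splits)
  qed
next
  assume R: "\<forall>x y z. x *s u + y *s v + z *s w = 0 \<longrightarrow> x = 0 \<and> y = 0 \<and> z = 0"
  have dist: "distinct [u, v, w]"
  proof -
    have "u \<noteq> v" using R[rule_format, of 1 "-1" 0] by (auto simp: vec_eq_iff)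
    moreover have "u \<noteq> w" using R[rule_format, of 1 0 "-1"] by (auto simp: vec_eq_iff)
    moreover have "v \<noteq> w" using R[rule_format, of 0 1 "-1"] by (auto simp: vec_eq_iff)
    ultimately show ?thesis by simp
  qed
  have "vec.independent {u, v, w}"
  proof
    assume "vec.dependent {u, v, w}"
    then obtain c where c: "\<exists>p\<in>{u, v, w}. c p \<noteq> 0" "(\<Sum>p\<in>{u, v, w}. c p *s p) = 0"
      by (auto simp: vec.dependent_finite)
    have "(\<Sum>p\<in>{u, v, w}. c p *s p) = c u *s u + c v *s v + c w *s w"
      using dist by (auto simp: add.assoc)
    with c R show False by auto
  qed
  with dist show "distinct [u, v, w] \<and> vec.independent {u, v, w}" by blast
qed

lemma matrix_inv_inverse:
  fixes A :: "'a::semiring_1^'n^'n"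
  assumes "invertible A"
  shows "A ** matrix_inv A = mat 1" "matrix_inv A ** A = mat 1"
  using someI_ex[OF assms[unfolded invertible_def]] by (simp_all add: matrix_inv_def)

lemma Pmat_mult_vec:
  "Pmat a b *v x = x $ 1 *s cvec a + x $ 2 *s b + x $ 3 *s cnj_vec b"
  by (simp add: vec_eq_iff matrix_vector_mult_def sum_3 Pmat_def transpose_def mult.commute)

lemma vec_mult_Pmat:
  "x v* Pmat a b =
     vector [\<Sum>i\<in>UNIV. cvec a $ i * x $ i, \<Sum>i\<in>UNIV. b $ i * x $ i, \<Sum>i\<in>UNIV. cnj (b $ i) * x $ i]"
  by (simp add: vec_eq_iff forall_3 vector_matrix_mult_def sum_3 Pmat_def cnj_vec_def transpose_def mult.commute)

lemma invertible_Pmat_iff: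
  "invertible (Pmat a b) \<longleftrightarrow>
     distinct [cvec a, b, cnj_vec b] \<and> vec.independent {cvec a, b, cnj_vec b}"
proof -
  have "(\<Sum>i\<in>UNIV. c i *s column i (Pmat a b)) = c 1 *s cvec a + c 2 *s b + c 3 *s cnj_vec b" for c
    by (simp add: vec_eq_iff sum_3 column_def Pmat_def transpose_def)
  then have "invertible (Pmat a b) \<longleftrightarrow>
    (\<forall>c :: 3 \<Rightarrow> complex. c 1 *s cvec a + c 2 *s b + c 3 *s cnj_vec b = 0 \<longrightarrow> (\<forall>i. c i = 0))"
    by (simp add: invertible_left_inverse matrix_left_invertible_independent_columns)
  also have "\<dots> \<longleftrightarrow> (\<forall>x y z. x *s cvec a + y *s b + z *s cnj_vec b = 0 \<longrightarrow> x = 0 \<and> y = 0 \<and> z = 0)"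
    (is "?A \<longleftrightarrow> ?B")
  proof
    assume A: ?A
    show ?B
    proof (intro allI impI)
      fix x y z assume "x *s cvec a + y *s b + z *s cnj_vec b = 0"
      with A[rule_format, of "\<lambda>i. vector [x, y, z] $ i"]
      have "\<And>i. (vector [x, y, z] :: complex^3) $ i = 0" by simp
      from this[of 1] this[of 2] this[of 3] show "x = 0 \<and> y = 0 \<and> z = 0" by simp
    qed
  qed (auto simp: forall_3)
  finally show ?thesis by (simp only: distinct_independent_3)
qed

lemma diag3_mult_vec: "diag3 x y z *v v = vector [x * v $ 1, y * v $ 2, z * v $ 3]"
  for x y z :: complex
  by (simp add: vec_eq_iff forall_3 matrix_vector_mult_def sum_3 diag3_def)

text \<open>The columns of A P = P D: the matrix is characterised by three eigenvector equations, so
  later arguments can avoid its definition through an inverse.\<close>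

lemma Mmat_eq_iff:
  assumes "invertible (Pmat a b)"
  shows "A = Mmat \<beta> a b \<longleftrightarrow>
    A *v cvec a = complex_of_real (1 / (cmod \<beta>)\<^sup>2) *s cvec a \<and> A *v b = \<beta> *s b \<and>
    A *v cnj_vec b = cnj \<beta> *s cnj_vec b"
proof -
  let ?P = "Pmat a b" and ?D = "diag3 (complex_of_real (1 / (cmod \<beta>)\<^sup>2)) \<beta> (cnj \<beta>)"
  have inv: "?P ** matrix_inv ?P = mat 1" "matrix_inv ?P ** ?P = mat 1"
    using assms by (simp_all add: matrix_inv_inverse)
  have "A = Mmat \<beta> a b \<longleftrightarrow> A ** ?P = ?P ** ?D"
  proof
    assume "A = Mmat \<beta> a b"
    then have "A ** ?P = ?P ** ?D ** (matrix_inv ?P ** ?P)"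
      by (simp only: Mmat_def matrix_mul_assoc)
    then show "A ** ?P = ?P ** ?D" by (simp add: inv)
  next
    assume "A ** ?P = ?P ** ?D"
    then have "A ** (?P ** matrix_inv ?P) = Mmat \<beta> a b"
      by (simp only: Mmat_def matrix_mul_assoc)
    then show "A = Mmat \<beta> a b" by (simp add: inv)
  qed
  also have "\<dots> \<longleftrightarrow> (\<forall>x. A *v (?P *v x) = ?P *v (?D *v x))"
    by (simp only: matrix_eq matrix_vector_mul_assoc)
  also have "\<dots> \<longleftrightarrow> A *v cvec a = complex_of_real (1 / (cmod \<beta>)\<^sup>2) *s cvec a \<and> A *v b = \<beta> *s b \<and>
    A *v cnj_vec b = cnj \<beta> *s cnj_vec b" (is "?L \<longleftrightarrow> ?R")
  proof
    assume L: ?L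
    show ?R
      using L[rule_format, of "vector [1, 0, 0]"] L[rule_format, of "vector [0, 1, 0]"]
        L[rule_format, of "vector [0, 0, 1]"]
      by (simp add: Pmat_mult_vec diag3_mult_vec)
  next
    assume ?R
    then show ?L
      by (simp add: Pmat_mult_vec diag3_mult_vec matrix_vector_right_distrib vector_scalar_commute
          vector_smult_assoc mult.commute)
  qed
  finally show ?thesis .
qed

section \<open>The translation lattice and the group of an Inoue surface\<close>

lemma holomorphic2_on_affine:
  "holomorphic2_on (\<lambda>(w, z). (c * w + d, e * z + f)) S"
  unfolding holomorphic2_on_def
proof
  fix p
  have "((\<lambda>v. (c * fst v + d, e * snd v + f)) has_derivative (\<lambda>v. (c * fst v, e * snd v))) (at p within S)"
    by (auto intro!: derivative_eq_intros)
  then show "\<exists>D. ((\<lambda>(w, z). (c * w + d, e * z + f)) has_derivative D) (at p within S) \<and>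
      (\<forall>c v. D (cscale c v) = cscale c (D v))"
    by (intro exI[of _ "\<lambda>v. (c * fst v, e * snd v)"]) (simp add: cscale_def split_def)
qed

lemma open_U_dom: "open U_dom"
  unfolding U_dom_def by (intro open_Times open_halfspace_Im_gt) simp

lemma convex_U_dom: "convex U_dom"
  unfolding U_dom_def by (intro convex_Times convex_halfspace_Im_gt) simp

lemma in_U_dom [simp]: "(w, z) \<in> U_dom \<longleftrightarrow> Im w > 0"
  by (simp add: U_dom_def)

locale inoue =
  fixes \<beta> :: complex and a :: "real^3" and b :: "complex^3"
  assumes adm: "admissible \<beta>" and comp: "compatible \<beta> a b"
begin

definition \<alpha> :: real where "\<alpha> = 1 / (cmod \<beta>)\<^sup>2"

text \<open>The pair (s m, t m) is the translation vector of the product of the powers of the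
  translation generators with exponents \<open>m $ i\<close>.\<close>

definition s :: "int^3 \<Rightarrow> real" where "s m = (\<Sum>i\<in>UNIV. a $ i * of_int (m $ i))"

definition t :: "int^3 \<Rightarrow> complex" where "t m = (\<Sum>i\<in>UNIV. b $ i * of_int (m $ i))"

abbreviation M where "M \<equiv> Mint \<beta> a b"

lemma \<beta>_nz: "\<beta> \<noteq> 0" and \<beta>_nonreal: "\<beta> \<notin> \<real>" and \<beta>_less: "cmod \<beta> < 1"
  using adm by (auto simp: admissible_def)

lemma \<alpha>_gt_1: "\<alpha> > 1"
  using \<beta>_less \<beta>_nz by (simp add: \<alpha>_def power_less_one_iff field_simps)

lemma \<alpha>_\<beta>: "complex_of_real \<alpha> * \<beta> * cnj \<beta> = 1"
  using \<beta>_nz complex_norm_square[of \<beta>]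
  by (simp add: \<alpha>_def mult.assoc flip: of_real_power) 

lemma invertible_P: "invertible (Pmat a b)"
  using comp unfolding invertible_Pmat_iff compatible_def by blast

lemma M_eigen:
  "map_matrix of_int M *v cvec a = complex_of_real \<alpha> *s cvec a"
  "map_matrix of_int M *v b = \<beta> *s b"
  "map_matrix of_int M *v cnj_vec b = cnj \<beta> *s cnj_vec b"
  using Mmat_eq_iff[OF invertible_P, of "map_matrix of_int M" \<beta>] map_matrix_Mint[OF comp]
  unfolding \<alpha>_def by blast+

lemma M_a: "(\<Sum>j\<in>UNIV. of_int (M $ i $ j) * a $ j) = \<alpha> * a $ i"
proof -
  have "complex_of_real (\<Sum>j\<in>UNIV. of_int (M $ i $ j) * a $ j) = complex_of_real (\<alpha> * a $ i)"
    using arg_cong[OF M_eigen(1), of "\<lambda>v. v $ i"] by (simp add: matrix_vector_mult_def cvec_def)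
  then show ?thesis using of_real_eq_iff by blast
qed

lemma M_b: "(\<Sum>j\<in>UNIV. of_int (M $ i $ j) * b $ j) = \<beta> * b $ i"
  using arg_cong[OF M_eigen(2), of "\<lambda>v. v $ i"] by (simp add: matrix_vector_mult_def)

lemma cubic:
  obtains \<theta>\<^sub>1 \<theta>\<^sub>2 :: int where
    "\<alpha> ^ 3 - of_int \<theta>\<^sub>2 * \<alpha>\<^sup>2 + of_int \<theta>\<^sub>1 * \<alpha> = 1"
    "\<beta> ^ 3 - of_int \<theta>\<^sub>2 * \<beta>\<^sup>2 + of_int \<theta>\<^sub>1 * \<beta> = 1"
proof -
  obtain \<theta>\<^sub>1 \<theta>\<^sub>2 :: int where
    roots: "{x :: complex. poly [:-1, of_int \<theta>\<^sub>1, - of_int \<theta>\<^sub>2, 1:] x = 0} = {complex_of_real \<alpha>, \<beta>, cnj \<beta>}"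
    using adm by (auto simp: admissible_def \<alpha>_def)
  have eq: "x ^ 3 - of_int \<theta>\<^sub>2 * x\<^sup>2 + of_int \<theta>\<^sub>1 * x = 1" if "x \<in> {complex_of_real \<alpha>, \<beta>, cnj \<beta>}" for x
    using that unfolding roots[symmetric] by (simp add: algebra_simps power3_eq_cube power2_eq_square)
  have "complex_of_real (\<alpha> ^ 3 - of_int \<theta>\<^sub>2 * \<alpha>\<^sup>2 + of_int \<theta>\<^sub>1 * \<alpha>) = complex_of_real 1"
    using eq[of "complex_of_real \<alpha>"] by simp
  then have "\<alpha> ^ 3 - of_int \<theta>\<^sub>2 * \<alpha>\<^sup>2 + of_int \<theta>\<^sub>1 * \<alpha> = 1" using of_real_eq_iff by blast
  then show thesis using that eq[of \<beta>] by simp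
qed

lemma s_add: "s (m + n) = s m + s n" and t_add: "t (m + n) = t m + t n"
  by (simp_all add: s_def t_def sum.distrib algebra_simps)

lemma s_scale: "s (c *s m) = of_int c * s m" and t_scale: "t (c *s m) = of_int c * t m"
  by (simp_all add: s_def t_def sum_distrib_left algebra_simps)

lemma s_minus: "s (- m) = - s m" and t_minus: "t (- m) = - t m"
  by (simp_all add: s_def t_def sum_negf)

lemma s_0 [simp]: "s 0 = 0" and t_0 [simp]: "t 0 = 0"
  by (simp_all add: s_def t_def)

lemma s_axis [simp]: "s (axis i 1) = a $ i" and t_axis [simp]: "t (axis i 1) = b $ i"
  by (simp_all add: s_def t_def axis_def if_distrib[of of_int] mult_if_delta if_distrib cong: if_cong)

text \<open>The witness is the transpose of M applied to m: pairing it with an eigenvector of M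
  multiplies the pairing with m by the eigenvalue. In group terms, the dilation conjugates
  translations of the lattice into such translations.\<close>

lemma s_t_shift: "\<exists>n. s n = \<alpha> * s m \<and> t n = \<beta> * t m"
proof (intro exI conjI)
  show "s (\<chi> j. \<Sum>i\<in>UNIV. M $ i $ j * m $ i) = \<alpha> * s m"
  proof -
    have "s (\<chi> j. \<Sum>i\<in>UNIV. M $ i $ j * m $ i) =
        (\<Sum>i\<in>UNIV. of_int (m $ i) * (\<Sum>j\<in>UNIV. of_int (M $ i $ j) * a $ j))"
      by (simp add: s_def sum_3 algebra_simps)
    then show ?thesis unfolding M_a by (simp add: s_def sum_distrib_left mult_ac)
  qed
  show "t (\<chi> j. \<Sum>i\<in>UNIV. M $ i $ j * m $ i) = \<beta> * t m"
  proof -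
    have "t (\<chi> j. \<Sum>i\<in>UNIV. M $ i $ j * m $ i) =
        (\<Sum>i\<in>UNIV. of_int (m $ i) * (\<Sum>j\<in>UNIV. of_int (M $ i $ j) * b $ j))"
      by (simp add: t_def sum_3 algebra_simps)
    then show ?thesis unfolding M_b by (simp add: t_def sum_distrib_left mult_ac)
  qed
qed

text \<open>Since \<open>\<alpha>\<close> and \<open>\<beta>\<close> are roots of \<open>X\<^sup>3 - \<theta>\<^sub>2 X\<^sup>2 + \<theta>\<^sub>1 X - 1\<close>, their inverses are given by the
  integer polynomial \<open>X\<^sup>2 - \<theta>\<^sub>2 X + \<theta>\<^sub>1\<close>.\<close>

lemma s_t_shift_inverse: "\<exists>n. s n = inverse \<alpha> * s m \<and> t n = inverse \<beta> * t m"
proof -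
  obtain \<theta>\<^sub>1 \<theta>\<^sub>2 :: int where \<theta>:
    "\<alpha> ^ 3 - of_int \<theta>\<^sub>2 * \<alpha>\<^sup>2 + of_int \<theta>\<^sub>1 * \<alpha> = 1"
    "\<beta> ^ 3 - of_int \<theta>\<^sub>2 * \<beta>\<^sup>2 + of_int \<theta>\<^sub>1 * \<beta> = 1"
    using cubic .
  have "\<alpha> * (\<alpha>\<^sup>2 - of_int \<theta>\<^sub>2 * \<alpha> + of_int \<theta>\<^sub>1) = 1" "\<beta> * (\<beta>\<^sup>2 - of_int \<theta>\<^sub>2 * \<beta> + of_int \<theta>\<^sub>1) = 1"
    using \<theta> by (simp_all add: algebra_simps power3_eq_cube power2_eq_square)
  then have inv: "inverse \<alpha> = \<alpha>\<^sup>2 - of_int \<theta>\<^sub>2 * \<alpha> + of_int \<theta>\<^sub>1"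
     "inverse \<beta> = \<beta>\<^sup>2 - of_int \<theta>\<^sub>2 * \<beta> + of_int \<theta>\<^sub>1"
    using inverse_unique by blast+
  obtain n1 where n1: "s n1 = \<alpha> * s m" "t n1 = \<beta> * t m" using s_t_shift by blast
  obtain n2 where n2: "s n2 = \<alpha> * s n1" "t n2 = \<beta> * t n1" using s_t_shift by blast
  show ?thesis
    by (rule exI[of _ "n2 + (- \<theta>\<^sub>2) *s n1 + \<theta>\<^sub>1 *s m"])
      (simp add: s_add t_add s_scale t_scale n1 n2 inv algebra_simps power2_eq_square)
qed

text \<open>Conjugation by any power of the dilation, positive or negative, keeps the translation
  lattice.\<close>

lemma s_t_power: "\<exists>n. s n = \<alpha> powi k * s m \<and> t n = \<beta> powi k * t m"
proof (induction k rule: int_induct[where k=0])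
  case base
  show ?case by (rule exI[of _ m]) simp
next
  case (step1 i)
  then obtain n where n: "s n = \<alpha> powi i * s m" "t n = \<beta> powi i * t m" by blast
  obtain n' where "s n' = \<alpha> * s n" "t n' = \<beta> * t n" using s_t_shift by blast
  then show ?case using n \<alpha>_gt_1 \<beta>_nz
    by (intro exI[of _ n']) (simp add: power_int_add)
next
  case (step2 i)
  then obtain n where n: "s n = \<alpha> powi i * s m" "t n = \<beta> powi i * t m" by blast
  obtain n' where "s n' = inverse \<alpha> * s n" "t n' = inverse \<beta> * t n" using s_t_shift_inverse by blast
  then show ?case using n \<alpha>_gt_1 \<beta>_nz
    by (intro exI[of _ n']) (simp add: power_int_diff divide_inverse)
qed

lemma of_int_mult_P:
  "(\<chi> i. of_int (m $ i)) v* Pmat a b = vector [complex_of_real (s m), t m, cnj (t m)]"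
  by (simp add: vec_mult_Pmat s_def t_def cvec_def)

lemma mult_P_inverse:
  "(x v* Pmat a b) v* matrix_inv (Pmat a b) = x"
  "(x v* matrix_inv (Pmat a b)) v* Pmat a b = x"
  by (simp_all add: vector_matrix_mul_assoc matrix_inv_inverse[OF invertible_P])

text \<open>The numbers s m, t m and the conjugate of t m are the entries of the row m times P, so
  the inverse of P recovers m linearly; integer entries of absolute value below 1 vanish.\<close>

lemma lattice_discrete: "\<exists>\<delta>>0. \<forall>m. \<bar>s m\<bar> < \<delta> \<longrightarrow> cmod (t m) < \<delta> \<longrightarrow> m = 0"
proof -
  define R where "R = matrix_inv (Pmat a b)"
  \<comment> \<open>Each absolute column sum of R is at most C - 1; the summand 1 makes C positive
    and the final estimate strict.\<close>
  define C where "C = (\<Sum>i\<in>UNIV. \<Sum>j\<in>UNIV. cmod (R $ j $ i)) + 1"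
  have "C > 0" by (simp add: C_def sum_nonneg add_nonneg_pos)
  show ?thesis
  proof (intro exI[of _ "1 / C"] conjI allI impI)
    fix m assume m: "\<bar>s m\<bar> < 1 / C" "cmod (t m) < 1 / C"
    define x :: "complex^3" where "x = vector [complex_of_real (s m), t m, cnj (t m)]"
    have x: "cmod (x $ j) \<le> 1 / C" for j
    proof -
      have "\<forall>j. cmod (x $ j) \<le> 1 / C" using m by (simp add: forall_3 x_def)
      then show ?thesis by blast
    qed
    have eq: "x v* R = (\<chi> i. of_int (m $ i))"
      unfolding R_def x_def of_int_mult_P[symmetric] mult_P_inverse ..
    have "m $ i = 0" for i
    proof -
      have "of_int \<bar>m $ i\<bar> = cmod ((x v* R) $ i)" by (simp add: eq)
      also have "\<dots> \<le> (\<Sum>j\<in>UNIV. cmod (R $ j $ i * x $ j))"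
        unfolding vector_matrix_mult_def by (simp add: norm_sum mult.commute)
      also have "\<dots> \<le> (\<Sum>j\<in>UNIV. cmod (R $ j $ i) * (1 / C))"
        by (intro sum_mono) (simp add: norm_mult mult_left_mono x del: mult_1_right times_divide_eq_right)
      also have "\<dots> = (\<Sum>j\<in>UNIV. cmod (R $ j $ i)) / C" by (simp add: sum_divide_distrib)
      also have "\<dots> < 1"
      proof -
        have "(\<Sum>j\<in>UNIV. cmod (R $ j $ i)) \<le> (\<Sum>i\<in>UNIV. \<Sum>j\<in>UNIV. cmod (R $ j $ i))"
          by (rule member_le_sum) (auto intro: sum_nonneg)
        then show ?thesis using \<open>C > 0\<close> by (simp add: C_def)
      qed
      finally show "m $ i = 0" by linarith
    qed
    then show "m = 0" by (simp add: vec_eq_iff)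
  qed (use \<open>C > 0\<close> in simp)
qed

text \<open>If s m = 0, shifting m by powers of the dilation keeps s = 0 while t shrinks like the
  powers of |\<beta>|; discreteness forces some shift, and with it t m, to vanish.\<close>

lemma s_inj:
  assumes "s m = 0"
  shows "m = 0"
proof -
  obtain \<delta> where \<delta>: "\<delta> > 0" "\<And>m. \<bar>s m\<bar> < \<delta> \<Longrightarrow> cmod (t m) < \<delta> \<Longrightarrow> m = 0"
    using lattice_discrete by blast
  have "(\<lambda>n. cmod \<beta> ^ n * cmod (t m)) \<longlonglongrightarrow> 0 * cmod (t m)"
    using \<beta>_less by (intro tendsto_mult_right LIMSEQ_power_zero) simp
  then have "eventually (\<lambda>n. cmod \<beta> ^ n * cmod (t m) < \<delta>) sequentially"
    using \<delta> order_tendstoD(2) by fastforce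
  then obtain n where n: "cmod \<beta> ^ n * cmod (t m) < \<delta>" by (auto simp: eventually_sequentially)
  obtain m' where m': "s m' = \<alpha> powi int n * s m" "t m' = \<beta> powi int n * t m"
    using s_t_power by blast
  then have "m' = 0" using \<delta> n assms by (simp add: norm_mult norm_power)
  then have "t m = 0" using m' \<beta>_nz by simp
  then show "m = 0" using \<delta> assms by simp
qed

lemma s_eq_iff: "s m = s n \<longleftrightarrow> m = n"
  using s_inj[of "m - n"] s_add[of m "- n"] s_minus[of n] by auto

text \<open>(x, z) has real coordinates r in the basis formed by the pairs of entries of a and b;
  rounding them down leaves an error bounded by the sizes of the generators.\<close>

lemma lattice_cover:
  "\<exists>m. \<bar>x - s m\<bar> \<le> (\<Sum>i\<in>UNIV. \<bar>a $ i\<bar>) \<and> cmod (z - t m) \<le> (\<Sum>i\<in>UNIV. cmod (b $ i))"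
proof -
  define r where "r = vector [complex_of_real x, z, cnj z] v* matrix_inv (Pmat a b)"
  have Pr: "r v* Pmat a b = vector [complex_of_real x, z, cnj z]"
    by (simp add: r_def mult_P_inverse)
  have comps: "(\<Sum>i\<in>UNIV. complex_of_real (a $ i) * r $ i) = complex_of_real x"
    "(\<Sum>i\<in>UNIV. b $ i * r $ i) = z" "(\<Sum>i\<in>UNIV. cnj (b $ i) * r $ i) = cnj z"
    using arg_cong[OF Pr, of "\<lambda>v. vec_nth v 1"] arg_cong[OF Pr, of "\<lambda>v. vec_nth v 2"] arg_cong[OF Pr, of "\<lambda>v. vec_nth v 3"]
    by (simp_all add: vec_mult_Pmat cvec_def)
  \<comment> \<open>Conjugation swaps the last two columns of P and the last two entries of the
    right-hand side, so the conjugate of r solves the same system; uniqueness makes r real.\<close>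
  have "cnj_vec r v* Pmat a b = vector [complex_of_real x, z, cnj z]"
    using arg_cong[OF comps(1), of cnj] arg_cong[OF comps(2), of cnj] arg_cong[OF comps(3), of cnj]
    by (simp add: vec_mult_Pmat cvec_def cnj_vec_def)
  with Pr have "cnj_vec r = r" using mult_P_inverse(1) by metis
  then have "cnj (r $ i) = r $ i" for i by (metis cnj_vec_def vec_lambda_beta)
  then have r: "r $ i = complex_of_real (Re (r $ i))" for i
    by (metis Reals_cnj_iff of_real_Re)
  define m :: "int^3" where "m = (\<chi> i. \<lfloor>Re (r $ i)\<rfloor>)"
  have frac: "\<bar>Re (r $ i) - of_int (m $ i)\<bar> \<le> 1" for i
    unfolding m_def by simp linarith
  have "complex_of_real (\<Sum>i\<in>UNIV. a $ i * Re (r $ i)) = complex_of_real x"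
    unfolding comps(1)[symmetric] of_real_sum of_real_mult by (intro sum.cong refl) (metis r)
  then have x: "(\<Sum>i\<in>UNIV. a $ i * Re (r $ i)) = x" using of_real_eq_iff by blast
  have "x - s m = (\<Sum>i\<in>UNIV. a $ i * (Re (r $ i) - of_int (m $ i)))"
    by (simp add: x[symmetric] s_def algebra_simps sum_subtractf)
  also have "\<bar>\<dots>\<bar> \<le> (\<Sum>i\<in>UNIV. \<bar>a $ i\<bar>)"
    by (rule order_trans[OF sum_abs sum_mono]) (simp add: abs_mult mult_left_le frac)
  finally have 1: "\<bar>x - s m\<bar> \<le> (\<Sum>i\<in>UNIV. \<bar>a $ i\<bar>)" .
  have "z = (\<Sum>i\<in>UNIV. b $ i * of_real (Re (r $ i)))"
    unfolding comps(2)[symmetric] by (intro sum.cong refl) (metis r)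
  then have "z - t m = (\<Sum>i\<in>UNIV. b $ i * of_real (Re (r $ i) - of_int (m $ i)))"
    by (simp add: t_def algebra_simps sum_subtractf)
  also have "cmod \<dots> \<le> (\<Sum>i\<in>UNIV. cmod (b $ i))"
    by (rule order_trans[OF norm_sum sum_mono])
      (simp add: norm_mult mult_left_le frac del: of_real_diff)
  finally show ?thesis using 1 by blast
qed

end

section \<open>The group in normal form and its free discontinuous action\<close>

context inoue
begin

definition aff :: "int \<Rightarrow> int^3 \<Rightarrow> complex \<times> complex \<Rightarrow> complex \<times> complex" where
  "aff k m = (\<lambda>(w, z). (complex_of_real (\<alpha> powi k) * w + complex_of_real (s m), \<beta> powi k * z + t m))"

lemma aff_in_U: "p \<in> U_dom \<Longrightarrow> aff k m p \<in> U_dom"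
  using \<alpha>_gt_1 by (cases p) (simp add: aff_def del: of_real_power_int)

lemma aff_0_0 [simp]: "aff 0 0 p = p"
  by (cases p) (simp add: aff_def)

text \<open>The semidirect product law: n' is n conjugated by the k-th power of the dilation; it
  exists by \<open>s_t_power\<close>.\<close>

lemma aff_aff:
  assumes "s n' = \<alpha> powi k * s n" "t n' = \<beta> powi k * t n"
  shows "aff k m (aff l n p) = aff (k + l) (m + n') p"
  using \<alpha>_gt_1 \<beta>_nz assms
  by (cases p) (simp add: aff_def s_add t_add power_int_add algebra_simps)

lemma aff_inverse: "\<exists>n. \<forall>p. aff (- k) n (aff k m p) = p \<and> aff k m (aff (- k) n p) = p"
proof -
  obtain n where n: "s n = \<alpha> powi (- k) * s m" "t n = \<beta> powi (- k) * t m" using s_t_power by blast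
  have n': "s (- m) = \<alpha> powi k * s (- n)" "t (- m) = \<beta> powi k * t (- n)"
    using n \<alpha>_gt_1 \<beta>_nz by (simp_all add: s_minus t_minus power_int_minus)
  show ?thesis
    using aff_aff[OF n, of "- n" k] aff_aff[OF n', of m "- k"]
    by (intro exI[of _ "- n"]) simp
qed

definition gen :: "int \<Rightarrow> int^3 \<Rightarrow> complex \<times> complex \<Rightarrow> complex \<times> complex" where
  "gen k m = restrict (aff k m) U_dom"

lemma gen_apply [simp]: "p \<in> U_dom \<Longrightarrow> gen k m p = aff k m p"
  by (simp add: gen_def)

lemma gen_Bij: "gen k m \<in> Bij U_dom"
proof -
  obtain n where "\<forall>p. aff (- k) n (aff k m p) = p \<and> aff k m (aff (- k) n p) = p"
    using aff_inverse by blast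
  then have "bij_betw (gen k m) U_dom U_dom"
    by (intro bij_betw_byWitness[where f' = "aff (- k) n"]) (auto simp: aff_in_U)
  then show ?thesis by (simp add: Bij_def gen_def)
qed

lemma gen_mult:
  assumes "s n' = \<alpha> powi k * s n" "t n' = \<beta> powi k * t n"
  shows "gen k m \<otimes>\<^bsub>BijGroup U_dom\<^esub> gen l n = gen (k + l) (m + n')"
proof -
  have "gen k m \<otimes>\<^bsub>BijGroup U_dom\<^esub> gen l n = compose U_dom (gen k m) (gen l n)"
    by (simp add: BijGroup_def gen_Bij)
  also have "\<dots> = gen (k + l) (m + n')"
  proof
    fix p show "compose U_dom (gen k m) (gen l n) p = gen (k + l) (m + n') p"
      by (cases "p \<in> U_dom") (simp_all add: compose_def aff_in_U aff_aff[OF assms], simp add: gen_def)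
  qed
  finally show ?thesis .
qed

lemma gen_one: "\<one>\<^bsub>BijGroup U_dom\<^esub> = gen 0 0"
  by (simp add: BijGroup_def gen_def restrict_def cong: if_cong)

lemma gen_inv: "\<exists>n. inv\<^bsub>BijGroup U_dom\<^esub> (gen k m) = gen (- k) n"
proof -
  interpret group "BijGroup U_dom" by (rule group_BijGroup)
  obtain n where n: "s n = \<alpha> powi (- k) * s m" "t n = \<beta> powi (- k) * t m" using s_t_power by blast
  have "gen (- k) (- n) \<otimes>\<^bsub>BijGroup U_dom\<^esub> gen k m = \<one>\<^bsub>BijGroup U_dom\<^esub>"
    unfolding gen_mult[OF n] gen_one by simp
  then have "inv\<^bsub>BijGroup U_dom\<^esub> (gen k m) = gen (- k) (- n)"
    by (rule inv_equality) (simp_all add: BijGroup_def gen_Bij)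
  then show ?thesis by blast
qed

text \<open>The maps \<open>gen k m\<close> include the generators and are closed under products and
  inverses. Conversely, powers of the dilation and multiples of unit vectors are reached by
  induction on integers, and every \<open>gen k m\<close> is a product of these.\<close>

lemma G_group_eq: "G_group \<beta> a b = {gen k m | k m. True}"
proof -
  interpret group "BijGroup U_dom" by (rule group_BijGroup)
  define X where "X = insert (gen 1 0) (range (\<lambda>i. gen 0 (axis i 1)))"
  have G: "G_group \<beta> a b = generate (BijGroup U_dom) X"
    by (simp add: G_group_def X_def gen_def aff_def \<alpha>_def)
  have X_carrier: "X \<subseteq> carrier (BijGroup U_dom)"
    by (auto simp: X_def BijGroup_def gen_Bij)
  interpret H: subgroup "generate (BijGroup U_dom) X" "BijGroup U_dom"
    by (rule generate_is_subgroup[OF X_carrier])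
  have X_sub: "x \<in> X \<Longrightarrow> x \<in> generate (BijGroup U_dom) X" for x by (rule generate.incl)
  have "g \<in> {gen k m | k m. True}" if "g \<in> generate (BijGroup U_dom) X" for g
    using that
  proof (induction rule: generate.induct)
    case one
    then show ?case using gen_one by blast
  next
    case (incl h)
    then show ?case by (auto simp: X_def)
  next
    case (inv h)
    then obtain k m where "h = gen k m" by (auto simp: X_def)
    then show ?case using gen_inv by blast
  next
    case (eng g h)
    then obtain k m l n where "g = gen k m" "h = gen l n" by auto
    then show ?case using gen_mult s_t_power by blast
  qed
  moreover have "gen k m \<in> generate (BijGroup U_dom) X" for k m
  proof -
    have mult: "gen 0 m \<otimes>\<^bsub>BijGroup U_dom\<^esub> gen k n = gen k (m + n)" for m k n
      using gen_mult[of n 0 n m k] by simp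
    have power: "gen k 0 \<in> generate (BijGroup U_dom) X" for k
    proof (induction k rule: int_induct[where k=0])
      case base
      show ?case using H.one_closed by (simp add: gen_one)
    next
      case (step1 i)
      then show ?case
        using H.m_closed[OF step1(2) X_sub[of "gen 1 0"]] gen_mult[of 0 i 0 0 1] by (simp add: X_def)
    next
      case (step2 i)
      have 1: "gen (-1) 0 \<otimes>\<^bsub>BijGroup U_dom\<^esub> gen 1 0 = \<one>\<^bsub>BijGroup U_dom\<^esub>"
        using gen_mult[of 0 "-1" 0 0 1] by (simp add: gen_one)
      have "inv\<^bsub>BijGroup U_dom\<^esub> (gen 1 0) = gen (-1) 0"
        by (rule inv_equality[OF 1]) (simp_all add: BijGroup_def gen_Bij)
      moreover have "inv\<^bsub>BijGroup U_dom\<^esub> (gen 1 0) \<in> generate (BijGroup U_dom) X"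
        using X_sub by (intro H.m_inv_closed) (simp add: X_def)
      ultimately show ?case
        using H.m_closed[OF step2(2), of "gen (-1) 0"] gen_mult[of 0 i 0 0 "-1"] by simp
    qed
    have neg: "gen 0 (- m) \<in> generate (BijGroup U_dom) X" if "gen 0 m \<in> generate (BijGroup U_dom) X" for m
    proof -
      have 1: "gen 0 (- m) \<otimes>\<^bsub>BijGroup U_dom\<^esub> gen 0 m = \<one>\<^bsub>BijGroup U_dom\<^esub>"
        using mult[of "- m" 0 m] by (simp add: gen_one)
      have "inv\<^bsub>BijGroup U_dom\<^esub> (gen 0 m) = gen 0 (- m)"
        by (rule inv_equality[OF 1]) (simp_all add: BijGroup_def gen_Bij)
      then show ?thesis using H.m_inv_closed[OF that] by simp
    qed
    have axis: "gen 0 (c *s axis i 1) \<in> generate (BijGroup U_dom) X" for c i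
    proof (induction c rule: int_induct[where k=0])
      case base
      show ?case using power[of 0] by simp
    next
      case (step1 c)
      have "c *s axis i 1 + axis i 1 = (c + 1) *s (axis i 1 :: int^3)" by (simp add: vec_eq_iff algebra_simps)
      then show ?case
        using H.m_closed[OF step1(2) X_sub[of "gen 0 (axis i 1)"]] mult[of "c *s axis i 1" 0 "axis i 1"]
        by (simp add: X_def)
    next
      case (step2 c)
      have "c *s axis i 1 + - axis i 1 = (c - 1) *s (axis i 1 :: int^3)" by (simp add: vec_eq_iff algebra_simps)
      then show ?case
        using H.m_closed[OF step2(2) neg[OF X_sub[of "gen 0 (axis i 1)"]]] mult[of "c *s axis i 1" 0 "- axis i 1"]
        by (simp add: X_def)
    qed
    have "m = m $ 1 *s axis 1 1 + (m $ 2 *s axis 2 1 + m $ 3 *s axis 3 1)"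
      by (simp add: vec_eq_iff forall_3 axis_def)
    then have "gen 0 m = gen 0 (m $ 1 *s axis 1 1) \<otimes>\<^bsub>BijGroup U_dom\<^esub>
        (gen 0 (m $ 2 *s axis 2 1) \<otimes>\<^bsub>BijGroup U_dom\<^esub> gen 0 (m $ 3 *s axis 3 1))"
      unfolding mult by simp
    then have "gen 0 m \<in> generate (BijGroup U_dom) X"
      using axis H.m_closed by metis
    moreover have "gen k m = gen 0 m \<otimes>\<^bsub>BijGroup U_dom\<^esub> gen k 0" by (simp add: mult)
    ultimately show ?thesis using power H.m_closed by metis
  qed
  ultimately show ?thesis unfolding G by blast
qed

lemma gen_in_G: "gen k m \<in> G_group \<beta> a b"
  using G_group_eq by blast

lemma in_GE:
  assumes "g \<in> G_group \<beta> a b"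
  obtains k m where "\<And>p. p \<in> U_dom \<Longrightarrow> g p = aff k m p"
  using assms gen_apply unfolding G_group_eq by blast

text \<open>Translations preserve imaginary parts, so these control the exponent k; once k = 0,
  discreteness of the lattice controls m.\<close>

lemma wandering:
  assumes "p \<in> U_dom"
  obtains V where "open V" "p \<in> V" "V \<subseteq> U_dom"
    "\<And>k m v. v \<in> V \<Longrightarrow> aff k m v \<in> V \<Longrightarrow> k = 0 \<and> m = 0"
proof -
  obtain w0 z0 where p: "p = (w0, z0)" by (cases p)
  define y where "y = Im w0"
  have "y > 0" using assms by (simp add: p y_def)
  obtain \<delta> where \<delta>: "\<delta> > 0" "\<And>m. \<bar>s m\<bar> < \<delta> \<Longrightarrow> cmod (t m) < \<delta> \<Longrightarrow> m = 0"
    using lattice_discrete by blast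
  \<comment> \<open>The first bound keeps differences within a ball below \<delta>. The second
    solves \<alpha> (y - \<epsilon>) = y + \<epsilon>, where the dilation moves the strip of
    imaginary parts between y - \<epsilon> and y + \<epsilon> off itself.\<close>
  define \<epsilon> where "\<epsilon> = min (\<delta> / 2) (y * (\<alpha> - 1) / (\<alpha> + 1))"
  have "\<epsilon> > 0" using \<delta> \<open>y > 0\<close> \<alpha>_gt_1 by (simp add: \<epsilon>_def)
  have "\<epsilon> \<le> y * (\<alpha> - 1) / (\<alpha> + 1)" by (simp add: \<epsilon>_def)
  then have \<epsilon>: "\<alpha> * (y - \<epsilon>) \<ge> y + \<epsilon>" using \<alpha>_gt_1 by (simp add: field_simps)
  have "y * (\<alpha> - 1) / (\<alpha> + 1) < y" using \<alpha>_gt_1 \<open>y > 0\<close> by (simp add: field_simps)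
  then have "\<epsilon> < y" by (simp add: \<epsilon>_def)
  have Im_near: "\<bar>Im w - y\<bar> < \<epsilon>" if "w \<in> ball w0 \<epsilon>" for w
    using abs_Im_le_cmod[of "w - w0"] that by (simp add: y_def dist_norm norm_minus_commute)
  show thesis
  proof (rule that)
    show "open (ball w0 \<epsilon> \<times> ball z0 \<epsilon>)" by (intro open_Times) auto
    show "p \<in> ball w0 \<epsilon> \<times> ball z0 \<epsilon>" using \<open>\<epsilon> > 0\<close> by (simp add: p)
    show "ball w0 \<epsilon> \<times> ball z0 \<epsilon> \<subseteq> U_dom"
    proof clarify
      fix w z assume "w \<in> ball w0 \<epsilon>"
      then show "(w, z) \<in> U_dom" using Im_near[of w] \<open>\<epsilon> < y\<close> by auto
    qed
  next
    fix k m v assume v: "v \<in> ball w0 \<epsilon> \<times> ball z0 \<epsilon>" "aff k m v \<in> ball w0 \<epsilon> \<times> ball z0 \<epsilon>"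
    obtain w z where wz: "v = (w, z)" by (cases v)
    define w' where "w' = complex_of_real (\<alpha> powi k) * w + complex_of_real (s m)"
    have w: "w \<in> ball w0 \<epsilon>" "w' \<in> ball w0 \<epsilon>" using v by (auto simp: wz aff_def w'_def)
    have Im: "Im w' = \<alpha> powi k * Im w" by (simp add: w'_def del: of_real_power_int)
    have Imw: "y - \<epsilon> < Im w" "Im w < y + \<epsilon>" "y - \<epsilon> < Im w'" "Im w' < y + \<epsilon>"
      using Im_near[OF w(1)] Im_near[OF w(2)] by linarith+
    have "k = 0"
    proof (rule ccontr)
      assume "k \<noteq> 0"
      then consider "k \<ge> 1" | "k \<le> -1" by linarith
      then show False
      proof cases
        case 1
        then have "\<alpha> \<le> \<alpha> powi k" using power_int_increasing[of 1 k \<alpha>] \<alpha>_gt_1 by simp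
        then have "\<alpha> * Im w \<le> Im w'"
          unfolding Im using Imw \<open>\<epsilon> < y\<close> by (intro mult_right_mono) auto
        moreover have "\<alpha> * (y - \<epsilon>) < \<alpha> * Im w" using Imw \<alpha>_gt_1 by simp
        ultimately show False using \<epsilon> Imw by linarith
      next
        case 2
        then have "\<alpha> powi k \<le> inverse \<alpha>"
          using power_int_increasing[of k "-1" \<alpha>] \<alpha>_gt_1 by (simp add: power_int_minus)
        then have "Im w' \<le> inverse \<alpha> * Im w"
          unfolding Im using Imw \<open>\<epsilon> < y\<close> by (intro mult_right_mono) auto
        then have "\<alpha> * Im w' \<le> Im w" using \<alpha>_gt_1 by (simp add: field_simps)
        moreover have "\<alpha> * (y - \<epsilon>) < \<alpha> * Im w'" using Imw \<alpha>_gt_1 by simp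
        ultimately show False using \<epsilon> Imw by linarith
      qed
    qed
    have near: "cmod (x' - x) < \<delta>" if "x \<in> ball c \<epsilon>" "x' \<in> ball c \<epsilon>" for x x' c
    proof -
      have "dist x' x < \<epsilon> + \<epsilon>" using that dist_triangle[of x' x c] by (simp add: dist_commute)
      also have "\<epsilon> \<le> \<delta> / 2" unfolding \<epsilon>_def by (rule min.cobounded1)
      then have "\<epsilon> + \<epsilon> \<le> \<delta>" by simp
      finally show ?thesis by (simp add: dist_norm)
    qed
    have "\<bar>s m\<bar> < \<delta>" using near[OF w] \<open>k = 0\<close> by (simp add: w'_def)
    moreover have "cmod (t m) < \<delta>"
      using near[of z z0 "z + t m"] v \<open>k = 0\<close> by (simp add: wz aff_def)
    ultimately show "k = 0 \<and> m = 0" using \<delta> \<open>k = 0\<close> by blast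
  qed
qed

lemma holomorphic2_aff: "holomorphic2_on (aff k m) S"
  unfolding aff_def by (rule holomorphic2_on_affine)

lemma G_holo_action: "holo_action U_dom (G_group \<beta> a b)"
proof
  show "open U_dom" by (rule open_U_dom)
next
  fix g assume "g \<in> G_group \<beta> a b"
  then obtain k m where g: "\<And>p. p \<in> U_dom \<Longrightarrow> g p = aff k m p" using in_GE by blast
  show hol: "holomorphic2_on g U_dom" using holomorphic2_on_cong[of U_dom g "aff k m"] g holomorphic2_aff by blast
  then show "continuous_on U_dom g" by (rule holomorphic2_on_imp_continuous_on)
  show "g x \<in> U_dom" if "x \<in> U_dom" for x using g aff_in_U that by simp
  obtain n where "\<And>p. aff (- k) n (aff k m p) = p" "\<And>p. aff k m (aff (- k) n p) = p"
    using aff_inverse by blast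
  then show "\<exists>h\<in>G_group \<beta> a b. \<forall>x\<in>U_dom. h (g x) = x \<and> g (h x) = x"
    using g aff_in_U by (intro bexI[OF _ gen_in_G[of "- k" n]]) simp
  fix h assume "h \<in> G_group \<beta> a b"
  then obtain l n where h: "\<And>p. p \<in> U_dom \<Longrightarrow> h p = aff l n p" using in_GE by blast
  obtain n' where "s n' = \<alpha> powi k * s n" "t n' = \<beta> powi k * t n" using s_t_power by blast
  then show "\<exists>k\<in>G_group \<beta> a b. \<forall>x\<in>U_dom. k x = g (h x)"
    using g h aff_in_U by (intro bexI[OF _ gen_in_G[of "k + l" "m + n'"]]) (simp add: aff_aff)
next
  show "\<exists>e\<in>G_group \<beta> a b. \<forall>x\<in>U_dom. e x = x"
    by (intro bexI[OF _ gen_in_G[of 0 0]]) simp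
next
  fix p assume "p \<in> U_dom"
  then obtain V where V: "open V" "p \<in> V" "V \<subseteq> U_dom"
    "\<And>k m v. v \<in> V \<Longrightarrow> aff k m v \<in> V \<Longrightarrow> k = 0 \<and> m = 0"
    using wandering by metis
  have "\<forall>z\<in>U_dom. g z = z" if "g \<in> G_group \<beta> a b" "y \<in> V" "g y \<in> V" for g y
  proof -
    obtain k m where g: "\<And>p. p \<in> U_dom \<Longrightarrow> g p = aff k m p" using in_GE \<open>g \<in> G_group \<beta> a b\<close> by blast
    then have "k = 0 \<and> m = 0" using V that by (metis subsetD)
    then show ?thesis using g by simp
  qed
  then show "\<exists>V. open V \<and> p \<in> V \<and> V \<subseteq> U_dom \<and>
      (\<forall>g\<in>G_group \<beta> a b. \<forall>y\<in>V. g y \<in> V \<longrightarrow> (\<forall>z\<in>U_dom. g z = z))"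
    using V by blast
qed

end

section \<open>Periodic holomorphic functions\<close>

text \<open>Complex linearity of D makes the restriction to a complex line in direction v
  differentiable with derivative D v, so one-variable theory applies along coordinate lines.\<close>

lemma holomorphic2_line:
  assumes "holomorphic2_on f S" "open S" "\<And>\<zeta>. \<zeta> \<in> T \<Longrightarrow> p + cscale \<zeta> v \<in> S"
  shows "(\<lambda>\<zeta>. fst (f (p + cscale \<zeta> v))) holomorphic_on T"
    and "(\<lambda>\<zeta>. snd (f (p + cscale \<zeta> v))) holomorphic_on T"
proof -
  have "\<exists>d. ((\<lambda>\<zeta>. fst (f (p + cscale \<zeta> v))) has_field_derivative fst d) (at \<zeta>) \<and>
            ((\<lambda>\<zeta>. snd (f (p + cscale \<zeta> v))) has_field_derivative snd d) (at \<zeta>)" if \<zeta>: "\<zeta> \<in> T" for \<zeta>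
  proof -
    obtain D where D: "(f has_derivative D) (at (p + cscale \<zeta> v))"
      "\<And>c v. D (cscale c v) = cscale c (D v)"
      using assms(1)[unfolded holomorphic2_on_open[OF assms(2)], rule_format, OF assms(3)[OF \<zeta>]]
      by metis
    have "((\<lambda>\<zeta>. p + cscale \<zeta> v) has_derivative (\<lambda>x. cscale x v)) (at \<zeta>)"
      unfolding cscale_def by (auto intro!: derivative_eq_intros)
    from has_derivative_compose[OF this D(1)]
    have *: "((\<lambda>\<zeta>. f (p + cscale \<zeta> v)) has_derivative (\<lambda>x. cscale x (D v))) (at \<zeta>)"
      by (simp add: D(2))
    have "((\<lambda>\<zeta>. fst (f (p + cscale \<zeta> v))) has_derivative (\<lambda>x. fst (D v) * x)) (at \<zeta>)"
      "((\<lambda>\<zeta>. snd (f (p + cscale \<zeta> v))) has_derivative (\<lambda>x. snd (D v) * x)) (at \<zeta>)"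
      using has_derivative_fst[OF *] has_derivative_snd[OF *] by (simp_all add: cscale_def mult.commute)
    then show ?thesis by (intro exI[of _ "D v"]) (simp add: has_field_derivative_def)
  qed
  then show "(\<lambda>\<zeta>. fst (f (p + cscale \<zeta> v))) holomorphic_on T"
    "(\<lambda>\<zeta>. snd (f (p + cscale \<zeta> v))) holomorphic_on T"
    unfolding holomorphic_on_def field_differentiable_def
    using has_field_derivative_at_within by blast+
qed

text \<open>The function 1 / (f + i) is entire and bounded by 1, because f + i has imaginary part
  above 1.\<close>

lemma entire_into_upper_half_plane_constant:
  assumes "f holomorphic_on UNIV" "\<And>z. Im (f z) > 0"
  shows "f z = f 0"
proof -
  have nz: "f z + \<i> \<noteq> 0" for z using assms(2)[of z] by (auto simp: complex_eq_iff)
  have "1 \<le> cmod (f z + \<i>)" for z using abs_Im_le_cmod[of "f z + \<i>"] assms(2)[of z] by simp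
  then have "cmod (1 / (f z + \<i>)) \<le> 1" for z by (simp add: norm_divide divide_le_eq_1 nz)
  then have "bounded (range (\<lambda>z. 1 / (f z + \<i>)))" by (auto intro!: boundedI)
  moreover have "(\<lambda>z. 1 / (f z + \<i>)) holomorphic_on UNIV"
    using nz by (intro holomorphic_intros assms)
  ultimately have "(\<lambda>z. 1 / (f z + \<i>)) constant_on UNIV" using Liouville_theorem by blast
  then obtain c where "\<And>z. 1 / (f z + \<i>) = c" by (auto simp: constant_on_def)
  then have "1 / (f z + \<i>) = 1 / (f 0 + \<i>)" by metis
  then show ?thesis using nz by (simp add: field_simps)
qed

lemma deriv_shift_eq:
  fixes f :: "complex \<Rightarrow> complex"
  assumes "f holomorphic_on S" "open S" "w \<in> S" "w + c \<in> S"
    and "\<And>w. w \<in> S \<Longrightarrow> w + c \<in> S \<Longrightarrow> f (w + c) = f w + d"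
  shows "deriv f (w + c) = deriv f w"
proof -
  have "(f has_field_derivative deriv f (w + c)) (at (w + c))"
    using holomorphic_derivI[OF assms(1,2,4)] .
  then have 1: "((\<lambda>w. f (w + c)) has_field_derivative deriv f (w + c)) (at w)"
    by (simp add: DERIV_shift)
  have "(f has_field_derivative deriv f w) (at w)" using holomorphic_derivI[OF assms(1,2,3)] .
  then have 2: "((\<lambda>w. f w + d) has_field_derivative deriv f w) (at w)"
    by (auto intro!: derivative_eq_intros)
  have "open (S \<inter> (\<lambda>w. w + c) -` S)"
    using assms(2) by (intro open_Int open_vimage continuous_intros)
  then have "((\<lambda>w. f (w + c)) has_field_derivative deriv f w) (at w)"
    by (rule has_field_derivative_transform_within_open[OF 2]) (use assms in auto)
  with 1 show ?thesis using DERIV_unique by blast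
qed

lemma constant_deriv_imp_affine:
  fixes f :: "complex \<Rightarrow> complex"
  assumes "f holomorphic_on S" "open S" "convex S" "\<And>w. w \<in> S \<Longrightarrow> deriv f w = c"
  obtains d where "\<And>w. w \<in> S \<Longrightarrow> f w = c * w + d"
proof -
  have "\<exists>d. \<forall>w\<in>S. f w - c * w = d"
  proof (rule has_field_derivative_zero_constant[OF assms(3)])
    fix w assume "w \<in> S"
    then have "(f has_field_derivative c) (at w)" using holomorphic_derivI[OF assms(1,2)] assms(4) by metis
    then have "((\<lambda>w. f w - c * w) has_field_derivative 0) (at w)"
      by (auto intro!: derivative_eq_intros)
    then show "((\<lambda>w. f w - c * w) has_field_derivative 0) (at w within S)"
      by (rule has_field_derivative_at_within)
  qed
  then obtain d where "\<forall>w\<in>S. f w - c * w = d" by blast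
  then show thesis using that[of d] by (simp add: algebra_simps)
qed

text \<open>The points w0 + \<tau> n accumulate at w0 and are eventually zeros of f - f w0, so the
  identity theorem applies.\<close>

lemma small_periods_imp_constant:
  fixes f :: "complex \<Rightarrow> complex" and \<tau> :: "nat \<Rightarrow> real"
  assumes "f holomorphic_on {w. Im w > 0}" "\<tau> \<longlonglongrightarrow> 0" "\<And>n. \<tau> n \<noteq> 0" "Im w0 > 0"
    and "eventually (\<lambda>n. f (w0 + complex_of_real (\<tau> n)) = f w0) sequentially" "Im w > 0"
  shows "f w = f w0"
proof (rule ccontr)
  assume neq: "f w \<noteq> f w0"
  have "(\<lambda>w. f w - f w0) holomorphic_on {w. Im w > 0}" by (intro holomorphic_intros assms)
  from isolated_zeros[OF this open_halfspace_Im_gt convex_connected[OF convex_halfspace_Im_gt], of w0 w]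
  obtain r where r: "r > 0" "\<And>z. z \<in> ball w0 r - {w0} \<Longrightarrow> f z - f w0 \<noteq> 0"
    using assms(4,6) neq by (metis diff_self eq_iff_diff_eq_0 mem_Collect_eq)
  have "eventually (\<lambda>n. \<bar>\<tau> n\<bar> < r) sequentially"
    by (rule order_tendstoD(2)[OF tendsto_rabs_zero[OF assms(2)] r(1)])
  with assms(5) have "eventually (\<lambda>n. f (w0 + complex_of_real (\<tau> n)) = f w0 \<and> \<bar>\<tau> n\<bar> < r) sequentially"
    by (rule eventually_conj)
  then obtain n where "f (w0 + complex_of_real (\<tau> n)) = f w0" "\<bar>\<tau> n\<bar> < r"
    by (auto simp: eventually_sequentially)
  with r(2)[of "w0 + complex_of_real (\<tau> n)"] assms(3)[of n] show False by (simp add: dist_norm)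
qed

text \<open>Negative powers of the dilation contract s of a fixed lattice vector, which is nonzero
  by \<open>s_inj\<close>.\<close>

lemma (in inoue) small_translations:
  obtains \<nu> :: "nat \<Rightarrow> int^3" where "(\<lambda>n. s (\<nu> n)) \<longlonglongrightarrow> 0" "\<And>n. s (\<nu> n) \<noteq> 0"
proof -
  define m0 :: "int^3" where "m0 = axis 1 1"
  have "m0 \<noteq> 0" by (simp add: m0_def axis_eq_0_iff)
  then have "s m0 \<noteq> 0" using s_inj by blast
  obtain \<nu> where \<nu>: "\<And>n. s (\<nu> n) = \<alpha> powi (- int n) * s m0"
    using s_t_power[of "- int _" m0] by metis
  have "s (\<nu> n) = inverse \<alpha> ^ n * s m0" for n
    using \<nu> by (simp add: power_int_minus power_inverse)
  moreover have "(\<lambda>n. inverse \<alpha> ^ n * s m0) \<longlonglongrightarrow> 0 * s m0"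
    using \<alpha>_gt_1 by (intro tendsto_mult_right LIMSEQ_power_zero) (simp add: field_simps)
  ultimately have "(\<lambda>n. s (\<nu> n)) \<longlonglongrightarrow> 0" by simp
  moreover have "s (\<nu> n) \<noteq> 0" for n using \<nu> \<open>s m0 \<noteq> 0\<close> \<alpha>_gt_1 by simp
  ultimately show thesis using that by blast
qed

section \<open>Lifts of biholomorphisms\<close>

text \<open>A lift in one direction only, so that the locale can be instantiated for a lift and for
  its inverse; one-sided facts such as \<open>\<alpha>_le\<close> then combine to
  equalities.\<close>

locale inoue_lift = X: inoue \<beta> a b + Y: inoue \<beta>' a' b' for \<beta> a b \<beta>' a' b' +
  fixes F :: "complex \<times> complex \<Rightarrow> complex \<times> complex"
  assumes F_holo: "holomorphic2_on F U_dom" and F_in: "F \<in> U_dom \<rightarrow> U_dom"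
    and F_inj: "inj_on F U_dom" and F_surj: "U_dom \<subseteq> F ` U_dom"
    and F_equivariant: "g \<in> G_group \<beta> a b \<Longrightarrow> \<exists>g'\<in>G_group \<beta>' a' b'. \<forall>x\<in>U_dom. F (g x) = g' (F x)"
begin

lemma F_aff: "\<exists>l n. \<forall>p\<in>U_dom. F (X.aff k m p) = Y.aff l n (F p)"
proof -
  obtain g where g: "g \<in> G_group \<beta>' a' b'" "\<And>x. x \<in> U_dom \<Longrightarrow> F (X.gen k m x) = g (F x)"
    using F_equivariant[OF X.gen_in_G[of k m]] by blast
  obtain l n where "\<And>p. p \<in> U_dom \<Longrightarrow> g p = Y.aff l n p" using Y.in_GE[OF g(1)] by blast
  then have "F (X.aff k m p) = Y.aff l n (F p)" if "p \<in> U_dom" for p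
    using g(2)[OF that] funcset_mem[OF F_in that] that by simp
  then show ?thesis by blast
qed

lemma F_cont: "continuous_on U_dom F"
  using F_holo by (rule holomorphic2_on_imp_continuous_on)

lemma F_Im: "Im w > 0 \<Longrightarrow> Im (fst (F (w, z))) > 0"
  using funcset_mem[OF F_in, of "(w, z)"] by (cases "F (w, z)") simp

lemma holo_z: "Im w > 0 \<Longrightarrow> (\<lambda>z. fst (F (w, z))) holomorphic_on UNIV"
  "Im w > 0 \<Longrightarrow> (\<lambda>z. snd (F (w, z))) holomorphic_on UNIV"
  using holomorphic2_line[OF F_holo open_U_dom, of UNIV "(w, 0)" "(0, 1)"]
  by (simp_all add: cscale_def)

lemma holo_w: "(\<lambda>w. fst (F (w, z))) holomorphic_on {w. Im w > 0}"
  "(\<lambda>w. snd (F (w, z))) holomorphic_on {w. Im w > 0}"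
  using holomorphic2_line[OF F_holo open_U_dom, of "{w. Im w > 0}" "(0, z)" "(1, 0)"]
  by (simp_all add: cscale_def)

definition h :: "complex \<Rightarrow> complex" where "h w = fst (F (w, 0))"

lemma fst_F: "Im w > 0 \<Longrightarrow> fst (F (w, z)) = h w"
  unfolding h_def by (rule entire_into_upper_half_plane_constant) (auto simp: holo_z F_Im)

lemma h_aff:
  assumes "\<forall>p\<in>U_dom. F (X.aff k m p) = Y.aff l n (F p)" "Im w > 0"
  shows "h (complex_of_real (X.\<alpha> powi k) * w + complex_of_real (X.s m)) =
     complex_of_real (Y.\<alpha> powi l) * h w + complex_of_real (Y.s n)"
proof -
  have "(w, 0) \<in> U_dom" using assms(2) by simp
  then have "fst (F (X.aff k m (w, 0))) = fst (Y.aff l n (F (w, 0)))" using assms(1) by simp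
  moreover have "Im (complex_of_real (X.\<alpha> powi k) * w + complex_of_real (X.s m)) > 0"
    using assms(2) X.\<alpha>_gt_1 by (simp del: of_real_power_int)
  ultimately show ?thesis
    using assms(2) fst_F by (simp add: X.aff_def Y.aff_def split_def del: of_real_power_int)
qed

lemma h_affine: "\<exists>\<kappa> \<mu>. \<kappa> \<noteq> 0 \<and> (\<forall>w. Im w > 0 \<longrightarrow> h w = \<kappa> * w + \<mu>)"
proof -
  let ?H = "{w. Im w > 0}"
  have h_holo: "h holomorphic_on ?H" unfolding h_def by (rule holo_w)
  obtain \<nu> where \<nu>: "(\<lambda>n. X.s (\<nu> n)) \<longlonglongrightarrow> 0" "\<And>n. X.s (\<nu> n) \<noteq> 0" using X.small_translations by blast
  have "\<forall>n. \<exists>l m. \<forall>p\<in>U_dom. F (X.aff 0 (\<nu> n) p) = Y.aff l m (F p)" using F_aff by blast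
  then obtain l m where lm: "\<And>n. \<forall>p\<in>U_dom. F (X.aff 0 (\<nu> n) p) = Y.aff (l n) (m n) (F p)"
    unfolding choice_iff by (elim exE) (rule that, blast)
  have h_lm: "h (w + complex_of_real (X.s (\<nu> n))) = complex_of_real (Y.\<alpha> powi l n) * h w + complex_of_real (Y.s (m n))"
    if "Im w > 0" for w n
    using h_aff[OF lm that] by simp
  have Im_h: "Im (h \<i>) > 0" using F_Im by (simp add: h_def)
  \<comment> \<open>The ratio of the imaginary parts of h at i + s (\<nu> n) and at i is the power
    of \<alpha>' with exponent l n. It tends to 1 by continuity, so eventually it lies strictly
    between 1/\<alpha>' and \<alpha>', which leaves l n = 0. As l n does not depend on the point,
    evaluating at i suffices.\<close>
  have l: "eventually (\<lambda>n. l n = 0) sequentially"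
  proof -
    have "isCont h \<i>"
      using holomorphic_on_imp_differentiable_at[OF h_holo open_halfspace_Im_gt]
      by (simp add: field_differentiable_imp_continuous_at)
    moreover have "(\<lambda>n. \<i> + complex_of_real (X.s (\<nu> n))) \<longlonglongrightarrow> \<i> + complex_of_real 0"
      by (intro tendsto_intros \<nu>)
    ultimately have "(\<lambda>n. h (\<i> + complex_of_real (X.s (\<nu> n)))) \<longlonglongrightarrow> h \<i>"
      using isCont_tendsto_compose by fastforce
    then have "(\<lambda>n. Im (h (\<i> + complex_of_real (X.s (\<nu> n)))) / Im (h \<i>)) \<longlonglongrightarrow> Im (h \<i>) / Im (h \<i>)"
      using Im_h by (intro tendsto_intros) auto
    moreover have "Im (h (\<i> + complex_of_real (X.s (\<nu> n)))) / Im (h \<i>) = Y.\<alpha> powi l n" for n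
      using Im_h h_lm[of \<i> n] by (simp del: of_real_power_int)
    ultimately have lim: "(\<lambda>n. Y.\<alpha> powi l n) \<longlonglongrightarrow> 1" using Im_h by simp
    have "eventually (\<lambda>n. Y.\<alpha> powi l n < Y.\<alpha>) sequentially"
      using order_tendstoD(2)[OF lim] Y.\<alpha>_gt_1 by simp
    moreover have "inverse Y.\<alpha> < 1" using Y.\<alpha>_gt_1 by (simp add: field_simps)
    then have "eventually (\<lambda>n. inverse Y.\<alpha> < Y.\<alpha> powi l n) sequentially"
      using order_tendstoD(1)[OF lim] by simp
    ultimately show ?thesis
    proof eventually_elim
      case (elim n)
      have "\<not> l n \<ge> 1" using elim power_int_increasing[of 1 "l n" Y.\<alpha>] Y.\<alpha>_gt_1 by auto
      moreover have "\<not> l n \<le> -1"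
        using elim power_int_increasing[of "l n" "-1" Y.\<alpha>] Y.\<alpha>_gt_1 by (auto simp: power_int_minus)
      ultimately show ?case by linarith
    qed
  qed
  have "deriv h w = deriv h \<i>" if "Im w > 0" for w
  proof (rule small_periods_imp_constant[OF _ \<nu> _ _ that])
    show "deriv h holomorphic_on ?H" by (intro holomorphic_deriv h_holo open_halfspace_Im_gt)
    show "eventually (\<lambda>n. deriv h (\<i> + complex_of_real (X.s (\<nu> n))) = deriv h \<i>) sequentially"
      using l
    proof eventually_elim
      case (elim n)
      show ?case
        by (rule deriv_shift_eq[OF h_holo open_halfspace_Im_gt, of _ _ "complex_of_real (Y.s (m n))"])
          (use h_lm[of _ n] elim in auto)
    qed
  qed simp
  then obtain \<mu> where \<mu>: "\<And>w. Im w > 0 \<Longrightarrow> h w = deriv h \<i> * w + \<mu>"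
    using constant_deriv_imp_affine[OF h_holo open_halfspace_Im_gt convex_halfspace_Im_gt] by (metis mem_Collect_eq)
  \<comment> \<open>Slope 0 would make the first coordinate of F constant, against
    surjectivity.\<close>
  moreover have "deriv h \<i> \<noteq> 0"
  proof
    assume "deriv h \<i> = 0"
    then have const: "fst (F p) = \<mu>" if "p \<in> U_dom" for p
      using that \<mu> fst_F by (cases p) auto
    have "(\<i>, 0) \<in> F ` U_dom" "(2 * \<i>, 0) \<in> F ` U_dom" using F_surj by auto
    with const have "\<i> = \<mu>" "2 * \<i> = \<mu>" by (metis fst_conv imageE)+
    then show False by simp
  qed
  ultimately show ?thesis by blast
qed

text \<open>The slope is fixed once by choice so that lemmas can share it; the additive constant is
  obtained anew where needed.\<close>

definition \<kappa> :: complex where "\<kappa> = (SOME \<kappa>. \<exists>\<mu>. \<kappa> \<noteq> 0 \<and> (\<forall>w. Im w > 0 \<longrightarrow> h w = \<kappa> * w + \<mu>))"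

lemma \<kappa>_nz: "\<kappa> \<noteq> 0" and ex_\<mu>: "\<exists>\<mu>. \<forall>w. Im w > 0 \<longrightarrow> h w = \<kappa> * w + \<mu>"
  using someI_ex[OF h_affine] unfolding \<kappa>_def by blast+

lemma fst_F_affine: "\<exists>\<mu>. \<forall>w z. Im w > 0 \<longrightarrow> fst (F (w, z)) = \<kappa> * w + \<mu>"
  using ex_\<mu> fst_F by auto

text \<open>With h affine, equivariance is an identity of affine functions of w. Its values at 2i
  and i isolate the linear coefficient; for k = 0 the constant term relates the two
  lattices.\<close>

lemma match_aff:
  assumes eqv: "\<forall>p\<in>U_dom. F (X.aff k m p) = Y.aff l n (F p)"
  shows "X.\<alpha> powi k = Y.\<alpha> powi l"
    and "k = 0 \<Longrightarrow> l = 0 \<and> \<kappa> * complex_of_real (X.s m) = complex_of_real (Y.s n)"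
proof -
  obtain \<mu> where \<mu>: "\<And>w. Im w > 0 \<Longrightarrow> h w = \<kappa> * w + \<mu>" using ex_\<mu> by blast
  have eq: "\<kappa> * (complex_of_real (X.\<alpha> powi k) * w + complex_of_real (X.s m)) + \<mu> =
     complex_of_real (Y.\<alpha> powi l) * (\<kappa> * w + \<mu>) + complex_of_real (Y.s n)" if "Im w > 0" for w
  proof -
    have "Im (complex_of_real (X.\<alpha> powi k) * w + complex_of_real (X.s m)) > 0"
      using that X.\<alpha>_gt_1 by (simp del: of_real_power_int)
    then show ?thesis using h_aff[OF eqv that] \<mu> that by metis
  qed
  have "\<kappa> * (complex_of_real (X.\<alpha> powi k) * (2 * \<i>) + complex_of_real (X.s m)) + \<mu> =
     complex_of_real (Y.\<alpha> powi l) * (\<kappa> * (2 * \<i>) + \<mu>) + complex_of_real (Y.s n)" by (rule eq) simp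
  moreover have "\<kappa> * (complex_of_real (X.\<alpha> powi k) * \<i> + complex_of_real (X.s m)) + \<mu> =
     complex_of_real (Y.\<alpha> powi l) * (\<kappa> * \<i> + \<mu>) + complex_of_real (Y.s n)" by (rule eq) simp
  ultimately have "\<kappa> * (complex_of_real (X.\<alpha> powi k) - complex_of_real (Y.\<alpha> powi l)) * \<i> = 0"
    by algebra
  then have "complex_of_real (X.\<alpha> powi k) = complex_of_real (Y.\<alpha> powi l)"
    using \<kappa>_nz by (simp del: of_real_power_int)
  then show \<alpha>: "X.\<alpha> powi k = Y.\<alpha> powi l" using of_real_eq_iff by blast
  assume "k = 0"
  have "l = 0"
  proof (rule ccontr)
    assume "l \<noteq> 0"
    then have "Y.\<alpha> powi l \<noteq> 1"
      using power_int_strict_increasing[of 0 l Y.\<alpha>] power_int_strict_increasing[of l 0 Y.\<alpha>] Y.\<alpha>_gt_1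
      by (cases "l > 0") auto
    with \<alpha> \<open>k = 0\<close> show False by simp
  qed
  with eq[of \<i>] \<open>k = 0\<close> show "l = 0 \<and> \<kappa> * complex_of_real (X.s m) = complex_of_real (Y.s n)"
    by (simp add: algebra_simps)
qed

lemma F_translation:
  "\<exists>n. \<kappa> * complex_of_real (X.s m) = complex_of_real (Y.s n) \<and>
     (\<forall>p\<in>U_dom. F (X.aff 0 m p) = Y.aff 0 n (F p))"
  using F_aff[of 0 m] match_aff(2) by blast

text \<open>\<alpha> is a power of \<alpha>', and both exceed 1, so the exponent is at least
  1.\<close>

lemma \<alpha>_le: "Y.\<alpha> \<le> X.\<alpha>"
proof -
  obtain l n where "\<forall>p\<in>U_dom. F (X.aff 1 0 p) = Y.aff l n (F p)" using F_aff by blast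
  from match_aff(1)[OF this] have l: "X.\<alpha> = Y.\<alpha> powi l" by simp
  have "l \<ge> 1"
  proof (rule ccontr)
    assume "\<not> l \<ge> 1"
    then have "Y.\<alpha> powi l \<le> Y.\<alpha> powi 0" using Y.\<alpha>_gt_1 by (intro power_int_increasing) auto
    then show False using l X.\<alpha>_gt_1 by simp
  qed
  then have "Y.\<alpha> powi 1 \<le> Y.\<alpha> powi l" using Y.\<alpha>_gt_1 by (intro power_int_increasing) auto
  then show ?thesis using l by simp
qed

text \<open>A finite difference in place of the z-derivative of the second component: the constants
  that translations add cancel in it, and holomorphy in each variable is immediate.\<close>

definition diff :: "complex \<Rightarrow> complex \<Rightarrow> complex \<Rightarrow> complex" where
  "diff \<zeta> w z = snd (F (w, z + \<zeta>)) - snd (F (w, z))"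

lemma diff_translation:
  assumes "Im w > 0"
  shows "diff \<zeta> (w + complex_of_real (X.s m)) (z + X.t m) = diff \<zeta> w z"
proof -
  obtain n where n: "\<forall>p\<in>U_dom. F (X.aff 0 m p) = Y.aff 0 n (F p)" using F_translation by blast
  have "snd (F (w + complex_of_real (X.s m), z + X.t m)) = snd (F (w, z)) + Y.t n" for z
    using assms bspec[OF n, of "(w, z)"] by (simp add: X.aff_def Y.aff_def split_def)
  from this[of z] this[of "z + \<zeta>"] show ?thesis by (simp add: diff_def add_ac)
qed

text \<open>Modulo the translations, each level set of the imaginary part of the first coordinate is compact,
  so a translation invariant function is bounded on it and Liouville's theorem applies.\<close>

lemma diff_constant:
  assumes "Im w > 0"
  shows "diff \<zeta> w z = diff \<zeta> w 0"
proof -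
  define A where "A = (\<Sum>i\<in>UNIV. \<bar>a $ i\<bar>)"
  define B where "B = (\<Sum>i\<in>UNIV. cmod (b $ i))"
  define y where "y = Im w"
  \<comment> \<open>A and B are the bounds of \<open>lattice_cover\<close>, so every point whose
    first coordinate has imaginary part y is a lattice translate of a point of K.\<close>
  define K where "K = (\<lambda>p :: real \<times> complex. (Complex (fst p) y, snd p)) ` (cball 0 A \<times> cball 0 B)"
  have "compact K"
    unfolding K_def Complex_eq by (intro compact_continuous_image compact_Times continuous_intros) auto
  have "K \<subseteq> U_dom" using assms by (auto simp: K_def y_def)
  have "continuous_on K (\<lambda>p. snd (F (fst p, snd p + \<zeta>)) - snd (F p))"
  proof (intro continuous_intros)
    show "continuous_on K (\<lambda>p. F (fst p, snd p + \<zeta>))"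
      by (rule continuous_on_compose2[OF F_cont])
        (use \<open>K \<subseteq> U_dom\<close> in \<open>auto intro!: continuous_intros\<close>)
    show "continuous_on K F" using F_cont \<open>K \<subseteq> U_dom\<close> continuous_on_subset by blast
  qed
  from compact_imp_bounded[OF compact_continuous_image[OF this \<open>compact K\<close>]]
  have "\<exists>C. \<forall>v\<in>(\<lambda>p. snd (F (fst p, snd p + \<zeta>)) - snd (F p)) ` K. cmod v \<le> C"
    unfolding bounded_iff .
  then obtain C where "\<forall>v\<in>(\<lambda>p. snd (F (fst p, snd p + \<zeta>)) - snd (F p)) ` K. cmod v \<le> C" ..
  then have C: "cmod (snd (F (fst p, snd p + \<zeta>)) - snd (F p)) \<le> C" if "p \<in> K" for p
    using that by simp
  have "cmod (diff \<zeta> w z) \<le> C" for z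
  proof -
    obtain m where m: "\<bar>Re w - X.s m\<bar> \<le> A" "cmod (z - X.t m) \<le> B"
      using X.lattice_cover[of "Re w" z] by (auto simp: A_def B_def)
    have w: "w - complex_of_real (X.s m) = Complex (Re w - X.s m) y" by (simp add: complex_eq_iff y_def)
    have "(w - complex_of_real (X.s m), z - X.t m) \<in> K"
      unfolding K_def w using m by (intro image_eqI[of _ _ "(Re w - X.s m, z - X.t m)"]) auto
    from C[OF this] have "cmod (diff \<zeta> (w - complex_of_real (X.s m)) (z - X.t m)) \<le> C"
      by (simp add: diff_def)
    then show ?thesis
      using diff_translation[of "w - complex_of_real (X.s m)" \<zeta> m "z - X.t m"] assms by simp
  qed
  then have "bounded (range (diff \<zeta> w))" by (auto intro!: boundedI)
  moreover have "(\<lambda>z. snd (F (w, z))) \<circ> (\<lambda>z. z + \<zeta>) holomorphic_on UNIV"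
    by (rule holomorphic_on_compose_gen[OF _ holo_z(2)[OF assms]]) (intro holomorphic_intros, simp)
  then have "(\<lambda>z. snd (F (w, z + \<zeta>))) holomorphic_on UNIV" by (simp add: o_def)
  then have "diff \<zeta> w holomorphic_on UNIV"
    unfolding diff_def by (intro holomorphic_intros holo_z assms)
  ultimately have "diff \<zeta> w constant_on UNIV" using Liouville_theorem by blast
  then show ?thesis by (auto simp: constant_on_def)
qed

lemma snd_F_affine:
  assumes "Im w > 0"
  shows "snd (F (w, z)) = diff 1 \<i> 0 * z + snd (F (w, 0))"
proof -
  define f where "f = (\<lambda>z. snd (F (w, z)))"
  have f_holo: "f holomorphic_on UNIV" unfolding f_def by (rule holo_z[OF assms])
  \<comment> \<open>Differences constant in z make f additive up to a constant; its derivative is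
    then constant and f is affine.\<close>
  have "f (z + \<zeta>) = f z + (f \<zeta> - f 0)" for z \<zeta>
    using diff_constant[OF assms, of \<zeta> z] by (simp add: diff_def f_def algebra_simps)
  then have "deriv f (0 + \<zeta>) = deriv f 0" for \<zeta>
    by (intro deriv_shift_eq[OF f_holo]) auto
  then obtain d where d: "\<And>z. f z = deriv f 0 * z + d"
    using constant_deriv_imp_affine[OF f_holo open_UNIV convex_UNIV, of "deriv f 0"] by auto
  have f: "f z = (f 1 - f 0) * z + f 0" using d[of z] d[of 1] d[of 0] by simp
  obtain \<nu> where \<nu>: "(\<lambda>n. X.s (\<nu> n)) \<longlonglongrightarrow> 0" "\<And>n. X.s (\<nu> n) \<noteq> 0" using X.small_translations by blast
  have "diff 1 w 0 = diff 1 \<i> 0"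
  proof (rule small_periods_imp_constant[OF _ \<nu> _ _ assms])
    show "(\<lambda>w. diff 1 w 0) holomorphic_on {w. Im w > 0}"
      unfolding diff_def by (intro holomorphic_intros holo_w)
    \<comment> \<open>The lattice translation also moves z by \<open>X.t (\<nu> n)\<close>;
      \<open>diff_constant\<close> moves it back to 0, leaving a comparison in w alone.\<close>
    have "diff 1 (\<i> + complex_of_real (X.s (\<nu> n))) 0 = diff 1 \<i> 0" for n
      using diff_translation[of \<i> 1 "\<nu> n" 0] diff_constant[of "\<i> + complex_of_real (X.s (\<nu> n))" 1 "X.t (\<nu> n)"] by simp
    then show "eventually (\<lambda>n. diff 1 (\<i> + complex_of_real (X.s (\<nu> n))) 0 = diff 1 \<i> 0) sequentially"
      by simp
  qed simp
  with f show ?thesis by (simp add: f_def diff_def)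
qed

text \<open>For equal \<alpha> the dilation goes to an element with exponent 1, and the coefficients
  of z in the equivariance relation give c \<beta> = c \<beta>'. This step tells \<beta> from its
  conjugate.\<close>

lemma \<beta>_eq:
  assumes "X.\<alpha> = Y.\<alpha>"
  shows "\<beta> = \<beta>'"
proof -
  obtain l n where ln: "\<forall>p\<in>U_dom. F (X.aff 1 0 p) = Y.aff l n (F p)" using F_aff by blast
  from match_aff(1)[OF this] have l: "Y.\<alpha> powi 1 = Y.\<alpha> powi l" using assms by simp
  have "l = 1"
  proof (rule ccontr)
    assume "l \<noteq> 1"
    then show False
      using power_int_strict_increasing[of 1 l Y.\<alpha>] power_int_strict_increasing[of l 1 Y.\<alpha>] Y.\<alpha>_gt_1 l
      by (cases "l > 1") auto
  qed
  define c where "c = diff 1 \<i> 0"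
  \<comment> \<open>For c = 0 the map F would take the same value at (i, 0) and (i, 1).\<close>
  have "c \<noteq> 0"
  proof
    assume "c = 0"
    then have "F (\<i>, 0) = F (\<i>, 1)"
      using snd_F_affine[of \<i> 1] fst_F[of \<i> 0] fst_F[of \<i> 1] by (simp add: c_def prod_eq_iff)
    then show False using inj_onD[OF F_inj] by fastforce
  qed
  define w where "w = complex_of_real X.\<alpha> * \<i>"
  have "Im w > 0" using X.\<alpha>_gt_1 by (simp add: w_def)
  have eq: "snd (F (w, \<beta> * z)) = \<beta>' * snd (F (\<i>, z)) + Y.t n" for z
    using bspec[OF ln, of "(\<i>, z)"] \<open>l = 1\<close> by (simp add: X.aff_def Y.aff_def split_def w_def)
  have "c * (\<beta> * z) + snd (F (w, 0)) = \<beta>' * (c * z + snd (F (\<i>, 0))) + Y.t n" for z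
    using eq[of z] snd_F_affine[of w "\<beta> * z"] snd_F_affine[of \<i> z] \<open>Im w > 0\<close> by (simp add: c_def)
  from this[of 0] this[of 1] have "c * \<beta> = c * \<beta>'" by (simp add: algebra_simps)
  with \<open>c \<noteq> 0\<close> show ?thesis by simp
qed

end

section \<open>Conjugacy of the integral matrices\<close>

text \<open>In this form Q and its integer inverse R can be produced independently, from the two
  mutually inverse lifts.\<close>

lemma conj_rel_iff:
  "(M, N) \<in> conj_rel \<longleftrightarrow> M \<in> calM \<and> N \<in> calM \<and>
     (\<exists>Q R. Q ** R = mat 1 \<and> R ** Q = mat 1 \<and> N ** Q = Q ** M)"
proof -
  have "(\<exists>Q. invertible Q \<and> N = Q ** M ** matrix_inv Q) \<longleftrightarrow>
        (\<exists>Q R. Q ** R = mat 1 \<and> R ** Q = mat 1 \<and> N ** Q = Q ** M)"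
  proof
    assume "\<exists>Q. invertible Q \<and> N = Q ** M ** matrix_inv Q"
    then obtain Q where Q: "invertible Q" "N = Q ** M ** matrix_inv Q" by blast
    then have "N ** Q = Q ** M ** (matrix_inv Q ** Q)" by (simp add: matrix_mul_assoc)
    then show "\<exists>Q R. Q ** R = mat 1 \<and> R ** Q = mat 1 \<and> N ** Q = Q ** M"
      using matrix_inv_inverse[OF Q(1)] by (intro exI[of _ Q] exI[of _ "matrix_inv Q"]) simp
  next
    assume "\<exists>Q R. Q ** R = mat 1 \<and> R ** Q = mat 1 \<and> N ** Q = Q ** M"
    then obtain Q R where Q: "Q ** R = mat 1" "R ** Q = mat 1" "N ** Q = Q ** M" by blast
    then have inv: "invertible Q" by (auto simp: invertible_def)
    have "Q ** M ** matrix_inv Q = N ** (Q ** matrix_inv Q)" by (simp add: Q matrix_mul_assoc)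
    then have "N = Q ** M ** matrix_inv Q" using matrix_inv_inverse[OF inv] by simp
    then show "\<exists>Q. invertible Q \<and> N = Q ** M ** matrix_inv Q" using inv by blast
  qed
  then show ?thesis by (simp add: conj_rel_def)
qed

lemma equiv_conj_rel: "equiv calM conj_rel"
proof (rule equivI)
  show "conj_rel \<subseteq> calM \<times> calM" by (auto simp: conj_rel_def)
  show "refl_on calM conj_rel"
    by (auto simp: refl_on_def conj_rel_iff intro!: exI[of _ "mat 1"])
  show "sym conj_rel"
  proof (rule symI)
    fix M N assume "(M, N) \<in> conj_rel"
    then obtain Q R where MN: "M \<in> calM" "N \<in> calM" and Q: "Q ** R = mat 1" "R ** Q = mat 1" "N ** Q = Q ** M"
      unfolding conj_rel_iff by blast
    have "R ** (N ** Q) ** R = R ** (Q ** M) ** R" by (simp add: Q)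
    then have "R ** N ** (Q ** R) = (R ** Q) ** M ** R" by (simp only: matrix_mul_assoc)
    then have "M ** R = R ** N" by (simp add: Q)
    then show "(N, M) \<in> conj_rel" unfolding conj_rel_iff using MN Q by blast
  qed
  show "trans conj_rel"
  proof (rule transI)
    fix L M N assume "(L, M) \<in> conj_rel" "(M, N) \<in> conj_rel"
    then obtain Q R Q' R' where LN: "L \<in> calM" "N \<in> calM"
      and Q: "Q ** R = mat 1" "R ** Q = mat 1" "M ** Q = Q ** L"
      and Q': "Q' ** R' = mat 1" "R' ** Q' = mat 1" "N ** Q' = Q' ** M"
      unfolding conj_rel_iff by blast
    have "(Q' ** Q) ** (R ** R') = Q' ** (Q ** R) ** R'" by (simp only: matrix_mul_assoc)
    moreover have "(R ** R') ** (Q' ** Q) = R ** (R' ** Q') ** Q" by (simp only: matrix_mul_assoc)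
    moreover have "N ** (Q' ** Q) = (Q' ** Q) ** L"
    proof -
      have "N ** (Q' ** Q) = (N ** Q') ** Q" by (simp only: matrix_mul_assoc)
      also have "\<dots> = Q' ** (M ** Q)" by (simp only: Q' matrix_mul_assoc)
      also have "\<dots> = (Q' ** Q) ** L" by (simp only: Q matrix_mul_assoc)
      finally show ?thesis .
    qed
    ultimately show "(L, N) \<in> conj_rel"
      unfolding conj_rel_iff using LN Q Q' by (metis matrix_mul_rid)
  qed
qed

lemma map_matrix_of_int_cvec:
  "map_matrix of_int N *v cvec v = cvec (map_matrix of_int N *v v)"
  by (simp add: vec_eq_iff matrix_vector_mult_def cvec_def)

lemma cvec_scale: "cvec (c *s v) = complex_of_real c *s cvec v"
  by (simp add: cvec_def vec_eq_iff)

lemma SpecR_imp_SpecC: "c \<in> SpecR N \<Longrightarrow> complex_of_real c \<in> SpecC N"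
proof -
  assume "c \<in> SpecR N"
  then obtain v where v: "v \<noteq> 0" "map_matrix of_int N *v v = c *s v"
    by (auto simp: SpecR_def eigenvalues_def)
  have "cvec v \<noteq> 0" using v(1) by (simp add: vec_eq_iff cvec_def)
  moreover have "map_matrix of_int N *v cvec v = complex_of_real c *s cvec v"
    by (simp only: map_matrix_of_int_cvec v(2) cvec_scale)
  ultimately show ?thesis by (auto simp: SpecC_def eigenvalues_def)
qed

lemma det_map_matrix_of_int: "det (map_matrix of_int N) = (of_int (det N) :: 'a::comm_ring_1)"
  for N :: "int^3^3"
  by (simp add: det_3)

context inoue
begin

text \<open>Expansion in the eigenbasis: a coefficient survives only where c is the eigenvalue of
  its basis vector. This bounds the spectrum and shows that eigenspaces are lines.\<close>

lemma eigenvector_decomposition: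
  assumes "map_matrix of_int M *v v = c *s v"
  obtains x y z where "v = x *s cvec a + y *s b + z *s cnj_vec b"
    "(complex_of_real \<alpha> - c) * x = 0" "(\<beta> - c) * y = 0" "(cnj \<beta> - c) * z = 0"
proof -
  let ?P = "Pmat a b"
  define x where "x = matrix_inv ?P *v v"
  have v: "v = ?P *v x"
    by (simp add: x_def matrix_vector_mul_assoc matrix_inv_inverse[OF invertible_P])
  define y :: "complex^3" where "y = vector [(complex_of_real \<alpha> - c) * x $ 1, (\<beta> - c) * x $ 2, (cnj \<beta> - c) * x $ 3]"
  have "map_matrix of_int M *v v = (complex_of_real \<alpha> * x $ 1) *s cvec a + (\<beta> * x $ 2) *s b + (cnj \<beta> * x $ 3) *s cnj_vec b"
    unfolding v Pmat_mult_vec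
    by (simp add: matrix_vector_right_distrib vector_scalar_commute M_eigen vector_smult_assoc mult.commute)
  with assms have "?P *v y = 0"
    unfolding v Pmat_mult_vec y_def by (simp add: vec_eq_iff algebra_simps)
  then have "matrix_inv ?P *v (?P *v y) = 0" by simp
  then have "y = 0" by (simp add: matrix_vector_mul_assoc matrix_inv_inverse[OF invertible_P])
  then have "vec_nth y 1 = 0" "vec_nth y 2 = 0" "vec_nth y 3 = 0" by simp_all
  then show thesis using that[of "vec_nth x 1" "vec_nth x 2" "vec_nth x 3"] v unfolding Pmat_mult_vec by (simp add: y_def)
qed

lemma a_nz: "cvec a \<noteq> 0" and b_nz: "b \<noteq> 0"
proof -
  have *: "\<forall>x y z. x *s cvec a + y *s b + z *s cnj_vec b = 0 \<longrightarrow> x = 0 \<and> y = 0 \<and> z = 0"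
    using invertible_P by (simp only: invertible_Pmat_iff distinct_independent_3)
  show "cvec a \<noteq> 0" using *[rule_format, of 1 0 0] by auto
  show "b \<noteq> 0" using *[rule_format, of 0 1 0] by auto
qed

lemma eigenvalues_distinct: "complex_of_real \<alpha> \<noteq> \<beta>" "complex_of_real \<alpha> \<noteq> cnj \<beta>" "cnj \<beta> \<noteq> \<beta>"
proof -
  show \<beta>: "complex_of_real \<alpha> \<noteq> \<beta>" "cnj \<beta> \<noteq> \<beta>"
    using \<beta>_nonreal Reals_of_real Reals_cnj_iff by metis+
  show "complex_of_real \<alpha> \<noteq> cnj \<beta>" using \<beta>(1) by (metis complex_cnj_cnj complex_cnj_complex_of_real)
qed

lemma SpecC_M: "SpecC M \<subseteq> {complex_of_real \<alpha>, \<beta>, cnj \<beta>}"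
proof
  fix c assume "c \<in> SpecC M"
  then obtain v where v: "v \<noteq> 0" "map_matrix of_int M *v v = c *s v"
    by (auto simp: SpecC_def eigenvalues_def)
  obtain x y z where "v = x *s cvec a + y *s b + z *s cnj_vec b"
    "(complex_of_real \<alpha> - c) * x = 0" "(\<beta> - c) * y = 0" "(cnj \<beta> - c) * z = 0"
    using eigenvector_decomposition[OF v(2)] .
  with v(1) show "c \<in> {complex_of_real \<alpha>, \<beta>, cnj \<beta>}" by auto
qed

lemma det_M: "det M = 1"
proof -
  let ?P = "Pmat a b"
  have "det ?P * det (matrix_inv ?P) = 1"
    using matrix_inv_inverse(1)[OF invertible_P] by (metis det_mul det_I)
  moreover have "det (diag3 (complex_of_real \<alpha>) \<beta> (cnj \<beta>)) = 1"
    using \<alpha>_\<beta> by (simp add: det_3 diag3_def)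
  ultimately have "det (Mmat \<beta> a b) = 1"
    unfolding Mmat_def det_mul \<alpha>_def by (simp add: mult.commute)
  then have "complex_of_int (det M) = 1"
    using det_map_matrix_of_int[of M, where 'a = complex] map_matrix_Mint[OF comp] by simp
  then show ?thesis by simp
qed

lemma \<beta>_in_SpecC: "\<beta> \<in> SpecC M"
  using M_eigen(2) b_nz by (auto simp: SpecC_def eigenvalues_def)

lemma \<beta>_Spec: "\<beta> \<in> SpecC M - complex_of_real ` SpecR M"
  using \<beta>_in_SpecC \<beta>_nonreal by (auto simp: Reals_def)

lemma M_calM: "M \<in> calM"
proof -
  have "c > 1" if "c \<in> SpecR M" for c
  proof -
    have "complex_of_real c \<in> {complex_of_real \<alpha>, \<beta>, cnj \<beta>}"
      using SpecR_imp_SpecC[OF that] SpecC_M by blast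
    moreover have "complex_of_real c \<noteq> \<beta>" using \<beta>_nonreal Reals_of_real by metis
    moreover from this have "complex_of_real c \<noteq> cnj \<beta>" by (metis complex_cnj_cnj complex_cnj_complex_of_real)
    ultimately show ?thesis using \<alpha>_gt_1 by simp
  qed
  moreover have "complex_of_real ` SpecR M \<subset> SpecC M"
    using SpecR_imp_SpecC \<beta>_Spec by blast
  ultimately show ?thesis using det_M by (auto simp: calM_def)
qed

lemma s_vec_mult: "s (m v* Q) = (\<Sum>i\<in>UNIV. of_int (m $ i) * s (Q $ i))"
proof -
  have "s (m v* Q) = (\<Sum>k\<in>UNIV. \<Sum>i\<in>UNIV. of_int (m $ i) * (a $ k * of_int (Q $ i $ k)))"
    by (simp add: s_def vector_matrix_mult_def sum_distrib_left mult_ac)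
  also have "\<dots> = (\<Sum>i\<in>UNIV. \<Sum>k\<in>UNIV. of_int (m $ i) * (a $ k * of_int (Q $ i $ k)))"
    by (rule sum.swap)
  finally show ?thesis by (simp add: s_def sum_distrib_left)
qed

lemma t_vec_mult: "t (m v* Q) = (\<Sum>i\<in>UNIV. of_int (m $ i) * t (Q $ i))"
proof -
  have "t (m v* Q) = (\<Sum>k\<in>UNIV. \<Sum>i\<in>UNIV. of_int (m $ i) * (b $ k * of_int (Q $ i $ k)))"
    by (simp add: t_def vector_matrix_mult_def sum_distrib_left mult_ac)
  also have "\<dots> = (\<Sum>i\<in>UNIV. \<Sum>k\<in>UNIV. of_int (m $ i) * (b $ k * of_int (Q $ i $ k)))"
    by (rule sum.swap)
  finally show ?thesis by (simp add: t_def sum_distrib_left)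
qed

lemma s_row_mult: "s ((A ** B) $ i) = (\<Sum>j\<in>UNIV. of_int (A $ i $ j) * s (B $ j))"
proof -
  have "(A ** B) $ i = A $ i v* B"
    by (simp add: vec_eq_iff matrix_matrix_mult_def vector_matrix_mult_def)
  then show ?thesis by (simp only: s_vec_mult)
qed

lemma s_row_M: "s (M $ i) = \<alpha> * a $ i"
  using M_a by (simp add: s_def mult.commute)

text \<open>Rows are lattice vectors and s is injective, so identities of integer matrices can be
  checked on real numbers.\<close>

lemma matrix_eqI_s:
  fixes A B :: "int^3^3"
  shows "(\<And>i. s (A $ i) = s (B $ i)) \<Longrightarrow> A = B"
  by (simp add: s_eq_iff vec_eq_iff)

lemma s_row_one: "s (mat 1 $ i) = a $ i"
proof -
  have "(mat 1 :: int^3^3) $ i = axis i 1" by (simp add: vec_eq_iff mat_def axis_def)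
  then show ?thesis by simp
qed

end

section \<open>From biholomorphic surfaces to equal eigenvalues and conjugate matrices\<close>

lemma biholomorphic_Inoue_surface_imp:
  assumes "inoue \<beta> a b" "inoue \<beta>' a' b'"
    and "biholomorphic (Inoue_surface \<beta> a b) (Inoue_surface \<beta>' a' b')"
  shows "\<beta> = \<beta>' \<and> (Mint \<beta> a b, Mint \<beta>' a' b') \<in> conj_rel"
proof -
  interpret X: inoue \<beta> a b by fact
  interpret Y: inoue \<beta>' a' b' by fact
  have U: "simply_connected U_dom" "U_dom \<noteq> {}"
    using convex_imp_simply_connected[OF convex_U_dom] in_U_dom[of \<i> 0] by (auto simp del: in_U_dom)
  obtain F H where F: "holomorphic2_on F U_dom" "F \<in> U_dom \<rightarrow> U_dom"
    and H: "holomorphic2_on H U_dom" "H \<in> U_dom \<rightarrow> U_dom"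
    and HF: "\<And>x. x \<in> U_dom \<Longrightarrow> H (F x) = x" and FH: "\<And>x. x \<in> U_dom \<Longrightarrow> F (H x) = x"
    and eqv: "\<And>g. g \<in> G_group \<beta> a b \<Longrightarrow> \<exists>g'\<in>G_group \<beta>' a' b'. \<forall>x\<in>U_dom. F (g x) = g' (F x)"
      "\<And>g. g \<in> G_group \<beta>' a' b' \<Longrightarrow> \<exists>g'\<in>G_group \<beta> a b. \<forall>x\<in>U_dom. H (g x) = g' (H x)"
    by (rule biholomorphic_quotE[OF X.G_holo_action Y.G_holo_action U U
          assms(3)[unfolded Inoue_surface_def]], rule that)
  interpret F: inoue_lift \<beta> a b \<beta>' a' b' F
  proof
    show "inj_on F U_dom" using HF by (rule inj_on_inverseI)
    show "U_dom \<subseteq> F ` U_dom" using FH H(2) by (metis funcset_mem image_eqI subsetI)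
  qed (use F eqv in auto)
  interpret H: inoue_lift \<beta>' a' b' \<beta> a b H
  proof
    show "inj_on H U_dom" using FH by (rule inj_on_inverseI)
    show "U_dom \<subseteq> H ` U_dom" using HF F(2) by (metis funcset_mem image_eqI subsetI)
  qed (use H eqv in auto)
  have \<alpha>: "X.\<alpha> = Y.\<alpha>" using F.\<alpha>_le H.\<alpha>_le by simp
  \<comment> \<open>H undoes F, so the slopes are inverse to each other; the values at i and 2i
    isolate their product.\<close>
  have \<kappa>: "H.\<kappa> * F.\<kappa> = 1"
  proof -
    obtain \<mu> where \<mu>: "\<And>w z. Im w > 0 \<Longrightarrow> fst (F (w, z)) = F.\<kappa> * w + \<mu>" using F.fst_F_affine by blast
    obtain \<mu>' where \<mu>': "\<And>w z. Im w > 0 \<Longrightarrow> fst (H (w, z)) = H.\<kappa> * w + \<mu>'" using H.fst_F_affine by blast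
    have "w = H.\<kappa> * (F.\<kappa> * w + \<mu>) + \<mu>'" if "Im w > 0" for w
    proof -
      have "H (F (w, 0)) = (w, 0)" using HF that by simp
      moreover have "fst (H (F (w, 0))) = H.\<kappa> * fst (F (w, 0)) + \<mu>'"
        using \<mu>'[OF F.F_Im[OF that], of 0 "snd (F (w, 0))"] by simp
      ultimately show ?thesis using \<mu>[OF that, of 0] by simp
    qed
    from this[of \<i>] this[of "2 * \<i>"]
    have "\<i> = H.\<kappa> * (F.\<kappa> * \<i> + \<mu>) + \<mu>'" "2 * \<i> = H.\<kappa> * (F.\<kappa> * (2 * \<i>) + \<mu>) + \<mu>'" by simp_all
    then have "H.\<kappa> * F.\<kappa> * \<i> = \<i>" by algebra
    then show ?thesis by simp
  qed
  have "\<forall>i. \<exists>n. F.\<kappa> * complex_of_real (a $ i) = complex_of_real (Y.s n)"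
    using F.F_translation[of "axis _ 1"] by auto
  then obtain r where r: "\<And>i. F.\<kappa> * complex_of_real (a $ i) = complex_of_real (Y.s (r i))" by metis
  have "\<forall>i. \<exists>n. H.\<kappa> * complex_of_real (a' $ i) = complex_of_real (X.s n)"
    using H.F_translation[of "axis _ 1"] by auto
  then obtain q where q: "\<And>i. H.\<kappa> * complex_of_real (a' $ i) = complex_of_real (X.s (q i))" by metis
  \<comment> \<open>In vector form R a' = \<open>F.\<kappa>\<close> a and Q a =
    \<open>H.\<kappa>\<close> a'. As the slopes are inverse, Q R fixes a' and R Q fixes a, so both
    are the identity by injectivity of s; likewise \<open>Y.M ** Q\<close> and
    \<open>Q ** X.M\<close> both send a to \<alpha> \<open>H.\<kappa>\<close> a'.\<close>
  define R where "R = (\<chi> i. r i)"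
  define Q where "Q = (\<chi> i. q i)"
  have sR: "complex_of_real (Y.s (R $ i)) = F.\<kappa> * complex_of_real (a $ i)"
    and sQ: "complex_of_real (X.s (Q $ i)) = H.\<kappa> * complex_of_real (a' $ i)" for i
    by (simp_all add: R_def Q_def q r)
  have s_QA: "complex_of_real (Y.s ((A ** R) $ i)) = F.\<kappa> * complex_of_real (X.s (A $ i))" for A i
    by (simp add: Y.s_row_mult sR X.s_def sum_distrib_left algebra_simps)
  have s_RA: "complex_of_real (X.s ((A ** Q) $ i)) = H.\<kappa> * complex_of_real (Y.s (A $ i))" for A i
    by (simp add: X.s_row_mult sQ Y.s_def sum_distrib_left algebra_simps)
  have "Q ** R = mat 1"
  proof (rule Y.matrix_eqI_s)
    fix i
    have "complex_of_real (Y.s ((Q ** R) $ i)) = H.\<kappa> * F.\<kappa> * complex_of_real (a' $ i)"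
      by (simp add: s_QA sQ)
    then show "Y.s ((Q ** R) $ i) = Y.s (mat 1 $ i)" by (simp add: \<kappa> Y.s_row_one)
  qed
  moreover have "R ** Q = mat 1"
  proof (rule X.matrix_eqI_s)
    fix i
    have "complex_of_real (X.s ((R ** Q) $ i)) = H.\<kappa> * F.\<kappa> * complex_of_real (a $ i)"
      by (simp add: s_RA sR)
    then show "X.s ((R ** Q) $ i) = X.s (mat 1 $ i)" by (simp add: \<kappa> X.s_row_one)
  qed
  moreover have "Y.M ** Q = Q ** X.M"
  proof (rule X.matrix_eqI_s)
    fix i
    have "complex_of_real (X.s ((Y.M ** Q) $ i)) = X.\<alpha> * (H.\<kappa> * complex_of_real (a' $ i))"
      by (simp add: s_RA Y.s_row_M \<alpha>)
    also have "\<dots> = X.\<alpha> * complex_of_real (X.s (Q $ i))" by (simp add: sQ)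
    also have "\<dots> = complex_of_real (X.\<alpha> * X.s (Q $ i))" by simp
    finally have "X.s ((Y.M ** Q) $ i) = X.\<alpha> * X.s (Q $ i)" using of_real_eq_iff by blast
    also have "\<dots> = X.s ((Q ** X.M) $ i)"
      by (simp add: X.s_row_mult X.s_row_M) (simp add: X.s_def sum_distrib_left algebra_simps)
    finally show "X.s ((Y.M ** Q) $ i) = X.s ((Q ** X.M) $ i)" .
  qed
  ultimately show ?thesis
    unfolding conj_rel_iff using F.\<beta>_eq[OF \<alpha>] X.M_calM Y.M_calM by blast
qed

section \<open>From conjugate matrices to biholomorphic surfaces\<close>

text \<open>The diagonal map with entries l and \<mu> commutes with the dilation and, since Q a = l
  a' and Q b = \<mu> b', conjugates translation by m into translation by m Q. Positivity of l
  preserves the half plane.\<close>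

lemma biholomorphic_Inoue_surface_scaling:
  fixes a a' :: "real^3" and b b' :: "complex^3" and Q R :: "int^3^3"
  assumes "inoue \<beta> a b" "inoue \<beta> a' b'"
    and Q: "Q ** R = mat 1" "R ** Q = mat 1" and "l > 0" "\<mu> \<noteq> 0"
    and Qa: "\<And>i. inoue.s a (Q $ i) = l * a' $ i" and Qb: "\<And>i. inoue.t b (Q $ i) = \<mu> * b' $ i"
  shows "biholomorphic (Inoue_surface \<beta> a b) (Inoue_surface \<beta> a' b')"
proof -
  interpret X: inoue \<beta> a b by fact
  interpret Y: inoue \<beta> a' b' by fact
  have s: "X.s (m v* Q) = l * Y.s m" for m
    by (simp add: X.s_vec_mult Qa Y.s_def sum_distrib_left algebra_simps)
  have t: "X.t (m v* Q) = \<mu> * Y.t m" for m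
    by (simp add: X.t_vec_mult Qb Y.t_def sum_distrib_left algebra_simps)
  have inv: "(m v* R) v* Q = m" for m
    by (simp add: vector_matrix_mul_assoc Q)
  have s': "l * Y.s (m v* R) = X.s m" and t': "\<mu> * Y.t (m v* R) = X.t m" for m
    using s[of "m v* R"] t[of "m v* R"] by (simp_all add: inv)
  define F :: "complex \<times> complex \<Rightarrow> complex \<times> complex" where
    "F = (\<lambda>(w, z). (complex_of_real (1 / l) * w + 0, 1 / \<mu> * z + 0))"
  define H :: "complex \<times> complex \<Rightarrow> complex \<times> complex" where
    "H = (\<lambda>(w, z). (complex_of_real l * w + 0, \<mu> * z + 0))"
  have F_in: "F p \<in> U_dom" and H_in: "H p \<in> U_dom" if "p \<in> U_dom" for p
    using that \<open>l > 0\<close> by (cases p; simp add: F_def H_def)+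
  have HF: "H (F p) = p" and FH: "F (H p) = p" for p
    using \<open>l > 0\<close> \<open>\<mu> \<noteq> 0\<close> by (cases p; simp add: F_def H_def)+
  have H_aff: "H (Y.aff k m p) = X.aff k (m v* Q) (H p)" for k m p
    by (cases p) (simp add: H_def X.aff_def Y.aff_def s t algebra_simps)
  have F_aff: "F (X.aff k m p) = Y.aff k (m v* R) (F p)" for k m p
  proof -
    have "H (Y.aff k (m v* R) (F p)) = X.aff k m p" by (simp add: H_aff inv HF)
    then show ?thesis using FH by metis
  qed
  show ?thesis
    unfolding Inoue_surface_def
  proof (rule biholomorphic_quotI[OF X.G_holo_action Y.G_holo_action _ _ _ _ HF FH])
    show "holomorphic2_on F U_dom" unfolding F_def by (rule holomorphic2_on_affine)
    show "holomorphic2_on H U_dom" unfolding H_def by (rule holomorphic2_on_affine)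
    show "F \<in> U_dom \<rightarrow> U_dom" "H \<in> U_dom \<rightarrow> U_dom" using F_in H_in by blast+
  next
    fix g x assume g: "g \<in> G_group \<beta> a b" and x: "x \<in> U_dom"
    obtain k m where "\<And>p. p \<in> U_dom \<Longrightarrow> g p = X.aff k m p" using X.in_GE[OF g] by blast
    then show "\<exists>g'\<in>G_group \<beta> a' b'. F (g x) = g' (F x)"
      using x F_in[OF x] F_aff by (intro bexI[OF _ Y.gen_in_G[of k "m v* R"]]) simp
  next
    fix g x assume g: "g \<in> G_group \<beta> a' b'" and x: "x \<in> U_dom"
    obtain k m where "\<And>p. p \<in> U_dom \<Longrightarrow> g p = Y.aff k m p" using Y.in_GE[OF g] by blast
    then show "\<exists>g'\<in>G_group \<beta> a b. H (g x) = g' (H x)"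
      using x H_in[OF x] H_aff by (intro bexI[OF _ X.gen_in_G[of k "m v* Q"]]) simp
  qed
qed

text \<open>Q carries eigenvectors of the first matrix to eigenvectors of the second for the same
  eigenvalue; as the eigenspaces are lines, this yields the factors of the diagonal map.\<close>

lemma biholomorphic_Inoue_surfaceI:
  assumes "inoue \<beta> a b" "inoue \<beta> a' b'" "(Mint \<beta> a b, Mint \<beta> a' b') \<in> conj_rel"
  shows "biholomorphic (Inoue_surface \<beta> a b) (Inoue_surface \<beta> a' b')"
proof -
  interpret X: inoue \<beta> a b by fact
  interpret Y: inoue \<beta> a' b' by fact
  obtain Q R where Q: "Q ** R = mat 1" "R ** Q = mat 1" "Y.M ** Q = Q ** X.M"
    using assms(3) unfolding conj_rel_iff by blast
  define q where "q = (map_matrix of_int Q :: complex^3^3)"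
  define r where "r = (map_matrix of_int R :: complex^3^3)"
  have rq: "r *v (q *v v) = v" for v
    by (simp add: matrix_vector_mul_assoc q_def r_def Q map_matrix_of_int_mat_1 flip: map_matrix_of_int_mult)
  have Mq: "map_matrix of_int Y.M *v (q *v v) = q *v (map_matrix of_int X.M *v v)" for v
    by (simp add: matrix_vector_mul_assoc q_def Q flip: map_matrix_of_int_mult)
  have "map_matrix of_int Y.M *v (q *v cvec a) = complex_of_real X.\<alpha> *s (q *v cvec a)"
    by (simp add: Mq X.M_eigen vector_scalar_commute)
  then obtain x y z where "q *v cvec a = x *s cvec a' + y *s b' + z *s cnj_vec b'"
    "(\<beta> - complex_of_real X.\<alpha>) * y = 0" "(cnj \<beta> - complex_of_real X.\<alpha>) * z = 0"
    by (rule Y.eigenvector_decomposition)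
  then have x: "q *v cvec a = x *s cvec a'" using X.eigenvalues_distinct by auto
  have "map_matrix of_int Y.M *v (q *v b) = \<beta> *s (q *v b)"
    by (simp add: Mq X.M_eigen vector_scalar_commute)
  then obtain x' \<mu> z' where "q *v b = x' *s cvec a' + \<mu> *s b' + z' *s cnj_vec b'"
    "(complex_of_real Y.\<alpha> - \<beta>) * x' = 0" "(cnj \<beta> - \<beta>) * z' = 0"
    by (rule Y.eigenvector_decomposition)
  then have \<mu>: "q *v b = \<mu> *s b'" using Y.eigenvalues_distinct by auto
  have "\<mu> \<noteq> 0" using rq[of b] X.b_nz unfolding \<mu> by auto
  have "x \<noteq> 0" using rq[of "cvec a"] X.a_nz unfolding x by auto
  have Qb: "X.t (Q $ i) = \<mu> * b' $ i" for i
    using arg_cong[OF \<mu>, of "\<lambda>v. v $ i"] by (simp add: X.t_def q_def matrix_vector_mult_def mult.commute)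
  have Qa_x: "complex_of_real (X.s (Q $ i)) = x * complex_of_real (a' $ i)" for i
    using arg_cong[OF x, of "\<lambda>v. v $ i"]
    by (simp add: X.s_def q_def matrix_vector_mult_def cvec_def mult.commute)
  \<comment> \<open>The factor is real because Q a and a' are real and a' is nonzero.\<close>
  obtain l where l: "x = complex_of_real l"
  proof -
    obtain i where "a' $ i \<noteq> 0" using Y.a_nz by (auto simp: vec_eq_iff cvec_def)
    then have "x = complex_of_real (X.s (Q $ i) / a' $ i)" using Qa_x[of i] by (simp add: field_simps)
    then show thesis using that by blast
  qed
  have Qa: "X.s (Q $ i) = l * a' $ i" for i
    using Qa_x[of i] unfolding l of_real_mult[symmetric] of_real_eq_iff .
  show ?thesis
  proof (cases "l > 0")
    case True
    then show ?thesis
      using biholomorphic_Inoue_surface_scaling[OF assms(1,2) Q(1,2) True \<open>\<mu> \<noteq> 0\<close> Qa Qb] by blast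
  next
    \<comment> \<open>A negative factor is repaired by -Q with inverse -R, which changes the signs
      of both l and \<mu>.\<close>
    case False
    then have "- l > 0" using \<open>x \<noteq> 0\<close> l by auto
    have neg: "(- A) ** (- B) = A ** B" for A B :: "int^3^3"
      by (simp add: matrix_matrix_mult_def vec_eq_iff)
    have "(- Q) ** (- R) = mat 1" "(- R) ** (- Q) = mat 1" by (simp_all add: neg Q)
    from biholomorphic_Inoue_surface_scaling[OF assms(1,2) this \<open>- l > 0\<close>, of "- \<mu>"] \<open>\<mu> \<noteq> 0\<close>
    show ?thesis by (simp add: X.s_minus X.t_minus Qa Qb)
  qed
qed

section \<open>Realising a prescribed matrix and eigenvalue by a surface\<close>

text \<open>The sum of the principal 2 by 2 minors: the second elementary symmetric function of the
  eigenvalues.\<close>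

definition trace_minors :: "int^3^3 \<Rightarrow> int" where
  "trace_minors M = (let m = \<lambda>i j :: 3. M $ i $ j in
     (m 1 1 * m 2 2 - m 1 2 * m 2 1) + (m 1 1 * m 3 3 - m 1 3 * m 3 1) + (m 2 2 * m 3 3 - m 2 3 * m 3 2))"

text \<open>One integer polynomial serves every field, which makes real and complex spectra
  comparable.\<close>

lemma eigenvalues_iff_charpoly:
  fixes c :: "'a::field"
  shows "c \<in> eigenvalues (map_matrix of_int M) \<longleftrightarrow>
    c ^ 3 - of_int (trace M) * c\<^sup>2 + of_int (trace_minors M) * c - of_int (det M) = 0"
proof -
  define A where "A = (map_matrix of_int M :: 'a^3^3)"
  have "(A - mat c) *v v = A *v v - c *s v" for v
    by (simp add: vec_eq_iff forall_3 matrix_vector_mult_def mat_def sum_3 algebra_simps)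
  then have "c \<in> eigenvalues A \<longleftrightarrow> \<not> (\<forall>v. (A - mat c) *v v = 0 \<longrightarrow> v = 0)"
    by (auto simp: eigenvalues_def)
  also have "\<dots> \<longleftrightarrow> \<not> invertible (A - mat c)"
    by (simp add: invertible_left_inverse matrix_left_invertible_ker)
  also have "\<dots> \<longleftrightarrow> det (A - mat c) = 0" by (simp add: invertible_det_nz)
  also have "det (A - mat c) =
      - (c ^ 3 - of_int (trace M) * c\<^sup>2 + of_int (trace_minors M) * c - of_int (det M))"
    by (simp add: A_def det_3 mat_def trace_def trace_minors_def Let_def sum_3 algebra_simps
        power2_eq_square power3_eq_cube)
  finally show ?thesis unfolding A_def neg_equal_0_iff_equal .
qed

lemma independent_eigenvectors_3:
  fixes A :: "'a::field^'n^'n"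
  assumes A: "A *v u = p *s u" "A *v v = q *s v" "A *v w = r *s w"
    and nz: "u \<noteq> 0" "v \<noteq> 0" "w \<noteq> 0" and pqr: "p \<noteq> q" "p \<noteq> r" "q \<noteq> r"
    and eq: "x *s u + y *s v + z *s w = 0"
  shows "x = 0 \<and> y = 0 \<and> z = 0"
proof -
  have 1: "(x * p) *s u + (y * q) *s v + (z * r) *s w = 0"
    using arg_cong[OF eq, of "\<lambda>v. A *v v"]
    by (simp add: matrix_vector_right_distrib vector_scalar_commute A vector_smult_assoc)
  have 2: "(x * p * p) *s u + (y * q * q) *s v + (z * r * r) *s w = 0"
    using arg_cong[OF 1, of "\<lambda>v. A *v v"]
    by (simp add: matrix_vector_right_distrib vector_scalar_commute A vector_smult_assoc)
  have e: "x * u $ i + y * v $ i + z * w $ i = 0" "x * p * u $ i + y * q * v $ i + z * r * w $ i = 0"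
    "x * p * p * u $ i + y * q * q * v $ i + z * r * r * w $ i = 0" for i
    using arg_cong[OF eq, of "\<lambda>v. v $ i"] arg_cong[OF 1, of "\<lambda>v. v $ i"] arg_cong[OF 2, of "\<lambda>v. v $ i"]
    by simp_all
  \<comment> \<open>The equations \<open>e\<close> form a Vandermonde system in p, q, r; each
    combination eliminates two of the three terms.\<close>
  have "x * (p - q) * (p - r) * u $ i = 0" "y * (q - p) * (q - r) * v $ i = 0"
    "z * (r - p) * (r - q) * w $ i = 0" for i
    using e[of i] by algebra+
  then have *: "x * u $ i = 0" "y * v $ i = 0" "z * w $ i = 0" for i
    using pqr by simp_all
  obtain i j k where "u $ i \<noteq> 0" "v $ j \<noteq> 0" "w $ k \<noteq> 0" using nz by (auto simp: vec_eq_iff)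
  then show ?thesis using *(1)[of i] *(2)[of j] *(3)[of k] by simp
qed

text \<open>The third root of the cubic is real, hence above 1 by \<open>calM\<close>; the product
  of the roots being 1, |\<beta>| < 1 follows. Eigenvectors for this root and for \<beta> serve as a
  and b.\<close>

lemma inoue_of_matrix:
  assumes M: "M \<in> calM" and \<beta>: "\<beta> \<in> SpecC M - complex_of_real ` SpecR M"
  obtains a b where "inoue \<beta> a b" "Mint \<beta> a b = M"
proof -
  define \<tau> where "\<tau> = trace M"
  define \<sigma> where "\<sigma> = trace_minors M"
  have "det M = 1" using M by (simp add: calM_def)
  have SpecC: "c \<in> SpecC M \<longleftrightarrow> c ^ 3 - of_int \<tau> * c\<^sup>2 + of_int \<sigma> * c - 1 = 0" for c
    by (simp add: SpecC_def eigenvalues_iff_charpoly \<tau>_def \<sigma>_def \<open>det M = 1\<close>)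
  have SpecR: "c \<in> SpecR M \<longleftrightarrow> c ^ 3 - of_int \<tau> * c\<^sup>2 + of_int \<sigma> * c - 1 = 0" for c
    by (simp add: SpecR_def eigenvalues_iff_charpoly \<tau>_def \<sigma>_def \<open>det M = 1\<close>)
  have real_SpecC: "complex_of_real c \<in> SpecC M \<longleftrightarrow> c \<in> SpecR M" for c
  proof -
    have "complex_of_real (c ^ 3 - of_int \<tau> * c\<^sup>2 + of_int \<sigma> * c - 1) =
        (complex_of_real c) ^ 3 - of_int \<tau> * (complex_of_real c)\<^sup>2 + of_int \<sigma> * complex_of_real c - 1"
      by simp
    then show ?thesis unfolding SpecC SpecR by (metis of_real_eq_0_iff)
  qed
  have nonreal: "\<beta> \<notin> \<real>" using \<beta> real_SpecC by (auto elim!: Reals_cases)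
  have eq: "\<beta> ^ 3 - of_int \<tau> * \<beta>\<^sup>2 + of_int \<sigma> * \<beta> - 1 = 0" using \<beta> SpecC by blast
  have eq': "(cnj \<beta>) ^ 3 - of_int \<tau> * (cnj \<beta>)\<^sup>2 + of_int \<sigma> * cnj \<beta> - 1 = 0"
    using arg_cong[OF eq, of cnj] by simp
  have "\<beta> - cnj \<beta> \<noteq> 0" using nonreal Reals_cnj_iff by auto
  \<comment> \<open>The difference of the cubic at \<beta> and at its conjugate, with the factor
    \<beta> minus its conjugate split off; the cofactor leads to Vieta's formulas below.\<close>
  moreover have "(\<beta> - cnj \<beta>) * (\<beta>\<^sup>2 + \<beta> * cnj \<beta> + (cnj \<beta>)\<^sup>2 - of_int \<tau> * (\<beta> + cnj \<beta>) + of_int \<sigma>) = 0"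
    using eq eq' by algebra
  ultimately have sym: "\<beta>\<^sup>2 + \<beta> * cnj \<beta> + (cnj \<beta>)\<^sup>2 - of_int \<tau> * (\<beta> + cnj \<beta>) + of_int \<sigma> = 0"
    by simp
  \<comment> \<open>The remaining root, read off from the sum \<tau> of the roots.\<close>
  define r where "r = of_int \<tau> - 2 * Re \<beta>"
  have r: "complex_of_real r = of_int \<tau> - \<beta> - cnj \<beta>" by (simp add: r_def complex_eq_iff)
  have \<sigma>: "of_int \<sigma> = \<beta> * cnj \<beta> + complex_of_real r * (\<beta> + cnj \<beta>)"
    unfolding r using sym by algebra
  have prod: "complex_of_real r * (\<beta> * cnj \<beta>) = 1"
    unfolding r using eq sym by algebra
  have factor: "c ^ 3 - of_int \<tau> * c\<^sup>2 + of_int \<sigma> * c - 1 = (c - complex_of_real r) * (c - \<beta>) * (c - cnj \<beta>)" for c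
    using prod \<sigma> r by algebra
  have "\<beta> \<noteq> 0" using nonreal by auto
  have "complex_of_real (r * (cmod \<beta>)\<^sup>2) = complex_of_real 1"
    using prod complex_norm_square[of \<beta>] by simp
  then have "r * (cmod \<beta>)\<^sup>2 = 1" using of_real_eq_iff by blast
  then have r_eq: "r = 1 / (cmod \<beta>)\<^sup>2" using \<open>\<beta> \<noteq> 0\<close> by (simp add: field_simps)
  have "complex_of_real r \<in> SpecC M" unfolding SpecC factor by simp
  then have rR: "r \<in> SpecR M" using real_SpecC by blast
  then have "r > 1" using M by (auto simp: calM_def)
  then have "(cmod \<beta>)\<^sup>2 < 1" using \<open>\<beta> \<noteq> 0\<close> by (simp add: r_eq field_simps)
  then have less: "cmod \<beta> < 1" by (simp add: power_less_one_iff abs_square_less_1)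
  have "{x. poly [:-1, of_int \<sigma>, - of_int \<tau>, 1:] x = 0} = {complex_of_real (1 / (cmod \<beta>)\<^sup>2), \<beta>, cnj \<beta>}"
  proof -
    have "poly [:-1, of_int \<sigma>, - of_int \<tau>, 1:] x = (x - complex_of_real r) * (x - \<beta>) * (x - cnj \<beta>)" for x
      unfolding factor[symmetric] by (simp add: algebra_simps power2_eq_square power3_eq_cube)
    then show ?thesis by (auto simp flip: r_eq)
  qed
  then have adm: "admissible \<beta>" unfolding admissible_def using nonreal less by blast
  obtain a where a: "a \<noteq> 0" "map_matrix of_int M *v a = r *s a"
    using rR by (auto simp: SpecR_def eigenvalues_def)
  obtain b where b: "b \<noteq> 0" "map_matrix of_int M *v b = \<beta> *s b"
    using \<beta> by (auto simp: SpecC_def eigenvalues_def)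
  have ca: "map_matrix of_int M *v cvec a = complex_of_real r *s cvec a"
    by (simp only: map_matrix_of_int_cvec a cvec_scale)
  have cb: "map_matrix of_int M *v cnj_vec b = cnj \<beta> *s cnj_vec b"
  proof (simp add: vec_eq_iff, intro allI)
    fix i
    have "cnj ((map_matrix of_int M *v b) $ i) = cnj ((\<beta> *s b) $ i)" by (simp add: b)
    then show "(map_matrix of_int M *v cnj_vec b) $ i = cnj \<beta> * cnj_vec b $ i"
      by (simp add: matrix_vector_mult_def cnj_vec_def)
  qed
  have nz: "cvec a \<noteq> 0" "cnj_vec b \<noteq> 0"
    using a(1) b(1) by (auto simp: vec_eq_iff cvec_def cnj_vec_def)
  have dist: "complex_of_real r \<noteq> \<beta>" "\<beta> \<noteq> cnj \<beta>"
    using nonreal Reals_of_real Reals_cnj_iff by metis+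
  then have "complex_of_real r \<noteq> cnj \<beta>" by (metis complex_cnj_cnj complex_cnj_complex_of_real)
  then have inv: "invertible (Pmat a b)"
    unfolding invertible_Pmat_iff distinct_independent_3
    using independent_eigenvectors_3[OF ca b(2) cb nz(1) b(1) nz(2)] dist by blast
  have Mm: "map_matrix of_int M = Mmat \<beta> a b"
    using Mmat_eq_iff[OF inv] ca b cb unfolding r_eq by blast
  then have comp: "compatible \<beta> a b"
    using inv unfolding invertible_Pmat_iff compatible_def by blast
  have "(map_matrix of_int (Mint \<beta> a b) :: complex^3^3) = map_matrix of_int M"
    using map_matrix_Mint[OF comp] Mm by simp
  then have "Mint \<beta> a b = M" by (simp add: vec_eq_iff)
  then show thesis using that adm comp by (simp add: inoue_def)
qed

section \<open>Classification by a complete invariant\<close>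

text \<open>S need not be injective, as a surface may arise from several parameters.
  \<open>\<Phi>\<close> therefore chooses a parameter for each class, and \<open>iff\<close> makes
  the invariant independent of the choice.\<close>

lemma bij_betw_quotient_classification:
  assumes r: "r \<subseteq> S ` T \<times> S ` T"
    and iff: "\<And>p p'. p \<in> T \<Longrightarrow> p' \<in> T \<Longrightarrow> (S p, S p') \<in> r \<longleftrightarrow> c p = c p'"
  obtains \<Phi> where "bij_betw \<Phi> ((S ` T) // r) (c ` T)" "\<And>p. p \<in> T \<Longrightarrow> \<Phi> (r `` {S p}) = c p"
proof -
  have class_eq: "r `` {S p} = r `` {S p'} \<longleftrightarrow> c p = c p'" if "p \<in> T" "p' \<in> T" for p p'
  proof
    assume "r `` {S p} = r `` {S p'}"
    moreover have "(S p', S p') \<in> r" using iff that by blast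
    ultimately have "(S p, S p') \<in> r" by blast
    then show "c p = c p'" using iff that by blast
  next
    assume "c p = c p'"
    have "(S p, S x) \<in> r \<longleftrightarrow> (S p', S x) \<in> r" if "x \<in> T" for x
      unfolding iff[OF \<open>p \<in> T\<close> that] iff[OF \<open>p' \<in> T\<close> that] \<open>c p = c p'\<close> ..
    then show "r `` {S p} = r `` {S p'}" using r by blast
  qed
  define \<Phi> where "\<Phi> = (\<lambda>K. c (SOME p. p \<in> T \<and> K = r `` {S p}))"
  have \<Phi>: "\<Phi> (r `` {S p}) = c p" if "p \<in> T" for p
  proof -
    let ?p = "SOME p'. p' \<in> T \<and> r `` {S p} = r `` {S p'}"
    have p: "?p \<in> T \<and> r `` {S p} = r `` {S ?p}"
      by (rule someI[of "\<lambda>p'. p' \<in> T \<and> r `` {S p} = r `` {S p'}" p]) (simp add: that)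
    then have "c p = c ?p" using class_eq[OF that, of ?p] by blast
    then show ?thesis by (simp only: \<Phi>_def)
  qed
  have quot: "(S ` T) // r = (\<lambda>p. r `` {S p}) ` T" by (auto simp: quotient_def)
  have "bij_betw \<Phi> ((S ` T) // r) (c ` T)"
    unfolding quot bij_betw_def inj_on_def image_image using \<Phi> class_eq by simp
  then show thesis using that \<Phi> by blast
qed

theorem theorem4p7:
  shows "(\<exists>\<Phi>.
    bij_betw \<Phi> (Inoue_surfaces_I // biholo_rel)
      {(K, \<beta>). K \<in> calM // conj_rel \<and> \<beta> \<in> class_SpecC K - complex_of_real ` class_SpecR K} \<and>
    (\<forall>\<beta> a b. admissible \<beta> \<and> compatible \<beta> a b \<longrightarrow>
      \<Phi> (biholo_rel `` {Inoue_surface \<beta> a b}) = (conj_rel `` {Mint \<beta> a b}, \<beta>))) \<and>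
    {(K, \<beta>). K \<in> calM // conj_rel \<and> \<beta> \<in> class_SpecC K - complex_of_real ` class_SpecR K} =
      (SIGMA K : calM // conj_rel. class_SpecC K - complex_of_real ` class_SpecR K)"
proof
  let ?B = "{(K, \<beta>). K \<in> calM // conj_rel \<and> \<beta> \<in> class_SpecC K - complex_of_real ` class_SpecR K}"
  define T where "T = {(\<beta>, a, b). inoue \<beta> a b}"
  define S where "S = (\<lambda>(\<beta>, a, b). Inoue_surface \<beta> a b)"
  define c where "c = (\<lambda>(\<beta>, a, b). (conj_rel `` {Mint \<beta> a b}, \<beta>))"
  have surfaces: "Inoue_surfaces_I = S ` T"
    by (force simp: Inoue_surfaces_I_def S_def T_def inoue_def)
  have rel: "(S p, S p') \<in> biholo_rel \<longleftrightarrow> c p = c p'" if "p \<in> T" "p' \<in> T" for p p'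
  proof -
    obtain \<beta> a b \<beta>' a' b' where p: "p = (\<beta>, a, b)" "p' = (\<beta>', a', b')"
      by (metis prod_cases3)
    then have I: "inoue \<beta> a b" "inoue \<beta>' a' b'" using that by (auto simp: T_def)
    have "c p = c p' \<longleftrightarrow> \<beta> = \<beta>' \<and> (Mint \<beta> a b, Mint \<beta>' a' b') \<in> conj_rel"
      using eq_equiv_class_iff[OF equiv_conj_rel inoue.M_calM[OF I(1)] inoue.M_calM[OF I(2)]]
      by (auto simp: p c_def)
    moreover have "(S p, S p') \<in> biholo_rel \<longleftrightarrow> biholomorphic (S p) (S p')"
      using that by (simp add: biholo_rel_def surfaces)
    ultimately show ?thesis
      using biholomorphic_Inoue_surface_imp[OF I] biholomorphic_Inoue_surfaceI[OF I(1)] I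
      by (auto simp: p S_def)
  qed
  have target: "c ` T = ?B"
  proof
    show "c ` T \<subseteq> ?B"
    proof clarify
      fix \<beta> a b K \<beta>' assume "(\<beta>, a, b) \<in> T" "(K, \<beta>') = c (\<beta>, a, b)"
      then have I: "inoue \<beta> a b" and K: "K = conj_rel `` {Mint \<beta> a b}" "\<beta>' = \<beta>"
        by (simp_all add: T_def c_def)
      show "K \<in> calM // conj_rel \<and> \<beta>' \<in> class_SpecC K - complex_of_real ` class_SpecR K"
        unfolding K class_Spec_eq[OF inoue.M_calM[OF I]]
        using inoue.M_calM[OF I] inoue.\<beta>_Spec[OF I] by (simp add: quotientI)
    qed
    show "?B \<subseteq> c ` T"
    proof clarify
      fix K \<beta> assume K: "K \<in> calM // conj_rel" "\<beta> \<in> class_SpecC K" "\<beta> \<notin> complex_of_real ` class_SpecR K"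
      then obtain M where M: "M \<in> calM" "K = conj_rel `` {M}" by (auto elim: quotientE)
      then have "\<beta> \<in> SpecC M - complex_of_real ` SpecR M" using K class_Spec_eq[OF M(1)] by simp
      then obtain a b where "inoue \<beta> a b" "Mint \<beta> a b = M" by (rule inoue_of_matrix[OF M(1)])
      then show "(K, \<beta>) \<in> c ` T"
        using M by (intro image_eqI[of _ _ "(\<beta>, a, b)"]) (simp_all add: c_def T_def)
    qed
  qed
  obtain \<Phi> where \<Phi>: "bij_betw \<Phi> ((S ` T) // biholo_rel) (c ` T)"
    "\<And>p. p \<in> T \<Longrightarrow> \<Phi> (biholo_rel `` {S p}) = c p"
  proof (rule bij_betw_quotient_classification[of biholo_rel S T c])
    show "biholo_rel \<subseteq> S ` T \<times> S ` T" unfolding surfaces[symmetric] by (auto simp: biholo_rel_def)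
  qed (use rel in auto)
  have "\<Phi> (biholo_rel `` {Inoue_surface \<beta> a b}) = (conj_rel `` {Mint \<beta> a b}, \<beta>)"
    if "admissible \<beta> \<and> compatible \<beta> a b" for \<beta> a b
    using \<Phi>(2)[of "(\<beta>, a, b)"] that by (simp add: T_def S_def c_def inoue_def)
  with \<Phi>(1) show "\<exists>\<Phi>. bij_betw \<Phi> (Inoue_surfaces_I // biholo_rel) ?B \<and>
    (\<forall>\<beta> a b. admissible \<beta> \<and> compatible \<beta> a b \<longrightarrow>
      \<Phi> (biholo_rel `` {Inoue_surface \<beta> a b}) = (conj_rel `` {Mint \<beta> a b}, \<beta>))"
    unfolding surfaces target by blast
  show "?B = (SIGMA K : calM // conj_rel. class_SpecC K - complex_of_real ` class_SpecR K)"
    by auto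
qed

end
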